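(* Let $q>2$ and let $\psi$ be a Young function relative to $\mu_{k,a}$. There exists a positive constant $D_q$ such that for every $f\in L^{(q)}_\psi(\mathbb{R}^N)$ \[\int_{\mathbb{R}^N}|\mathcal{F}_{k,a}f(\xi)|^q\,d\mu_{k,a}(\xi)\le D_q^q\,\|f\|^q_{(q),\psi}.\]
   Context: Let $N\ge1$ and let $\langle\cdot,\cdot\rangle$, $\|\cdot\|$ be the Euclidean inner product and norm on $\mathbb{R}^N$. Let $\mathcal{R}\subset\mathbb{R}^N\setminus\{0\}$ be a reduced root system with positive subsystem $\mathcal{R}^+$, let $r_\alpha(x)=x-2\frac{\langle\alpha,x\rangle}{\|\alpha\|^2}\alpha$, let $\mathfrak{C}$ be the finite group generated by the $r_\alpha$, and let $k:\mathcal{R}\to[0,\infty)$, $\alpha\mapsto k_\alpha$, be a $\mathfrak{C}$-invariant (multiplicity) function; $\langle k\rangle=\sum_{\alpha\in\mathcal{R}^+}k_\alpha$. For $a>0$ put $\vartheta_k(x)=\prod_{\alpha\in\mathcal{R}^+}|\langle\alpha,x\rangle|^{2k_\alpha}$, $\vartheta_{k,a}(x)=\|x\|^{a-2}\vartheta_k(x)$, $d\mu_{k,a}(x)=\vartheta_{k,a}(x)\,dx$, $L^p_{k,a}(\mathbb{R}^N)=L^p(\mathbb{R}^N,\mu_{k,a})$. The Dunkl Laplacian is $\Delta_kf(x)=\Delta f(x)+\sum_{\alpha\in\mathcal{R}^+}k_\alpha\bigl(\frac{2\langle\nabla f(x),\alpha\rangle}{\langle\alpha,x\rangle}-\|\alpha\|^2\frac{f(x)-f(r_\alpha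 x)}{\langle\alpha,x\rangle^2}\bigr)$. Assume $a+2\langle k\rangle+N>2$. The $(k,a)$-generalized Fourier transform is the unitary operator on $L^2_{k,a}(\mathbb{R}^N)$ given by $\mathcal{F}_{k,a}=\exp\bigl[\frac{i\pi}{2a}(2\langle k\rangle+N+a-2)\bigr]\exp\bigl[\frac{i\pi}{2a}(\|x\|^{2-a}\Delta_k-\|x\|^a)\bigr]$. Equivalently, it is the unitary operator determined by $\mathcal{F}_{k,a}\Phi_{\ell}(p,\cdot)=e^{-i\pi(\ell+m/a)}\Phi_\ell(p,\cdot)$ for $\ell,m\in\{0,1,2,\dots\}$ and $p$ a homogeneous polynomial of degree $m$ with $\Delta_kp=0$, where $\Phi_\ell(p,x)=p(x)L_\ell^{(\lambda_m)}(\frac2a\|x\|^a)e^{-\|x\|^a/a}$, $\lambda_m=\frac1a(2m+2\langle k\rangle+N-2)$, and $L_\ell^{(\lambda)}$ are Laguerre polynomials (these functions span a dense subspace). Standing assumption (boundedness of the integral kernel): there is a finite constant $C_0$ with $\|\mathcal{F}_{k,a}f\|_\infty\le C_0\|f\|_{L^1_{k,a}}$ for all $f\in L^1_{k,a}\cap L^2_{k,a}$. Then $\mathcal{F}_{k,a}$ extends by continuity to $L^1_{k,a}+L^2_{k,a}$. A Young function relative to $\mu_{k,a}$ is a measurable function $\psi:\mathbb{R}^N\to\mathbb{R}$ for which there is a constant $c$ with $\mu_{k,a}(\{x:|\psi(x)|\le t\})\le c\,t$ for all $t>0$. For such $\psi$ and $2<q<\infty$, $L^{(q)}_\psi(\mathbb{R}^N)$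 is the space of measurable $f$ on $\mathbb{R}^N$ with $\|f\|_{(q),\psi}:=\bigl(\int_{\mathbb{R}^N}|f(x)|^q|\psi(x)|^{q-2}\,d\mu_{k,a}(x)\bigr)^{1/q}<\infty$ (these functions belong to $L^1_{k,a}+L^2_{k,a}$, so $\mathcal{F}_{k,a}f$ is defined). *)

theory Defs
  imports "HOL-Analysis.Analysis" "HOL-Probability.Essential_Supremum"
begin

section \<open>Root systems and multiplicity functions\<close>

definition reflection :: "real^'n \<Rightarrow> real^'n \<Rightarrow> real^'n" where
  "reflection \<alpha> x = x - (2 * (\<alpha> \<bullet> x) / (norm \<alpha>)\<^sup>2) *\<^sub>R \<alpha>"

text \<open>As usual for Dunkl operators, neither integrality nor spanning is required.\<close>

definition reduced_root_system :: "(real^'n) set \<Rightarrow> bool" where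
  "reduced_root_system R \<longleftrightarrow> finite R \<and> 0 \<notin> R \<and>
     (\<forall>\<alpha>\<in>R. reflection \<alpha> ` R = R) \<and>
     (\<forall>\<alpha>\<in>R. R \<inter> range (\<lambda>c. c *\<^sub>R \<alpha>) = {\<alpha>, - \<alpha>})"

definition positive_subsystem :: "(real^'n) set \<Rightarrow> (real^'n) set \<Rightarrow> bool" where
  "positive_subsystem R Rp \<longleftrightarrow>
     (\<exists>v. (\<forall>\<alpha>\<in>R. v \<bullet> \<alpha> \<noteq> 0) \<and> Rp = {\<alpha> \<in> R. v \<bullet> \<alpha> > 0})"

text \<open>Reflections are involutions, so closing under composition already gives the generated group.\<close>

inductive_set reflection_group :: "(real^'n) set \<Rightarrow> (real^'n \<Rightarrow> real^'n) set"
  for R :: "(real^'n) set" where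
  "id \<in> reflection_group R"
| "\<alpha> \<in> R \<Longrightarrow> g \<in> reflection_group R \<Longrightarrow> reflection \<alpha> \<circ> g \<in> reflection_group R"

definition multiplicity_function :: "(real^'n) set \<Rightarrow> (real^'n \<Rightarrow> real) \<Rightarrow> bool" where
  "multiplicity_function R k \<longleftrightarrow>
     (\<forall>\<alpha>\<in>R. k \<alpha> \<ge> 0) \<and> (\<forall>g\<in>reflection_group R. \<forall>\<alpha>\<in>R. k (g \<alpha>) = k \<alpha>)"

definition k_index :: "(real^'n) set \<Rightarrow> (real^'n \<Rightarrow> real) \<Rightarrow> real" where
  "k_index Rp k = (\<Sum>\<alpha>\<in>Rp. k \<alpha>)"

section \<open>The weighted measure and its Lebesgue spaces\<close>

text \<open>The convention \<open>0 powr s = 0\<close> (also for \<open>s \<le> 0\<close>) affects these weights only on the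
  reflecting hyperplanes and at the origin, which are Lebesgue null sets.\<close>

definition weight_k :: "(real^'n) set \<Rightarrow> (real^'n \<Rightarrow> real) \<Rightarrow> real^'n \<Rightarrow> real" where
  "weight_k Rp k x = (\<Prod>\<alpha>\<in>Rp. \<bar>\<alpha> \<bullet> x\<bar> powr (2 * k \<alpha>))"

definition weight_ka :: "(real^'n) set \<Rightarrow> (real^'n \<Rightarrow> real) \<Rightarrow> real \<Rightarrow> real^'n \<Rightarrow> real" where
  "weight_ka Rp k a x = norm x powr (a - 2) * weight_k Rp k x"

definition mu_ka :: "(real^'n) set \<Rightarrow> (real^'n \<Rightarrow> real) \<Rightarrow> real \<Rightarrow> (real^'n) measure" where
  "mu_ka Rp k a = density lebesgue (\<lambda>x. ennreal (weight_ka Rp k a x))"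

text \<open>Elements of the spaces below are functions rather than classes modulo null sets; all
  identities between them are therefore stated almost everywhere.\<close>

definition Lp_space :: "'a measure \<Rightarrow> real \<Rightarrow> ('a \<Rightarrow> complex) set" where
  "Lp_space M p = {f \<in> borel_measurable M. integrable M (\<lambda>x. norm (f x) powr p)}"

definition Lp_norm :: "'a measure \<Rightarrow> real \<Rightarrow> ('a \<Rightarrow> complex) \<Rightarrow> real" where
  "Lp_norm M p f = (\<integral>x. norm (f x) powr p \<partial>M) powr (1 / p)"

definition Linfty_norm :: "'a measure \<Rightarrow> ('a \<Rightarrow> complex) \<Rightarrow> ennreal" where
  "Linfty_norm M f = esssup M (\<lambda>x. ennreal (norm (f x)))"

definition L2_inner :: "'a measure \<Rightarrow> ('a \<Rightarrow> complex) \<Rightarrow> ('a \<Rightarrow> complex) \<Rightarrow> complex" where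
  "L2_inner M f g = (\<integral>x. f x * cnj (g x) \<partial>M)"

definition unitary_on_L2 ::
    "'a measure \<Rightarrow> (('a \<Rightarrow> complex) \<Rightarrow> ('a \<Rightarrow> complex)) \<Rightarrow> bool" where
  "unitary_on_L2 M F \<longleftrightarrow>
     (\<forall>f\<in>Lp_space M 2. F f \<in> Lp_space M 2) \<and>
     (\<forall>f\<in>Lp_space M 2. \<forall>g\<in>Lp_space M 2. \<forall>c d.
        AE x in M. F (\<lambda>y. c * f y + d * g y) x = c * F f x + d * F g x) \<and>
     (\<forall>f\<in>Lp_space M 2. \<forall>g\<in>Lp_space M 2. L2_inner M (F f) (F g) = L2_inner M f g) \<and>
     (\<forall>g\<in>Lp_space M 2. \<exists>f\<in>Lp_space M 2. AE x in M. F f x = g x)"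

section \<open>Dunkl Laplacian and \<open>k\<close>-harmonic polynomials\<close>

definition partial_deriv :: "'n \<Rightarrow> (real^'n \<Rightarrow> complex) \<Rightarrow> real^'n \<Rightarrow> complex" where
  "partial_deriv i f x = frechet_derivative f (at x) (axis i 1)"

definition laplacian :: "(real^'n \<Rightarrow> complex) \<Rightarrow> real^'n \<Rightarrow> complex" where
  "laplacian f x = (\<Sum>i\<in>UNIV. partial_deriv i (partial_deriv i f) x)"

text \<open>The directional derivative of \<open>f\<close> along \<open>\<alpha>\<close> is the pairing of the gradient with \<open>\<alpha>\<close>.
  The formula is meaningful only off the reflecting hyperplanes.\<close>

definition dunkl_laplacian ::
    "(real^'n) set \<Rightarrow> (real^'n \<Rightarrow> real) \<Rightarrow> (real^'n \<Rightarrow> complex) \<Rightarrow> real^'n \<Rightarrow> complex" where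
  "dunkl_laplacian Rp k f x = laplacian f x +
     (\<Sum>\<alpha>\<in>Rp. k \<alpha> *\<^sub>R
        ((2 / (\<alpha> \<bullet> x)) *\<^sub>R frechet_derivative f (at x) \<alpha>
         - ((norm \<alpha>)\<^sup>2 / (\<alpha> \<bullet> x)\<^sup>2) *\<^sub>R (f x - f (reflection \<alpha> x))))"

definition homogeneous_polynomial :: "nat \<Rightarrow> (real^'n \<Rightarrow> complex) \<Rightarrow> bool" where
  "homogeneous_polynomial m p \<longleftrightarrow>
     (\<exists>c. \<forall>x. p x = (\<Sum>\<beta> | (\<Sum>i\<in>UNIV. \<beta> i) = m.
                        c \<beta> * complex_of_real (\<Prod>i\<in>UNIV. (x $ i) ^ \<beta> i)))"

text \<open>For a polynomial \<open>p\<close> the Dunkl Laplacian is again a polynomial, hence vanishes identically iff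
  it vanishes off the reflecting hyperplanes. On them division by zero would give wrong values.\<close>

definition k_harmonic :: "(real^'n) set \<Rightarrow> (real^'n \<Rightarrow> real) \<Rightarrow> (real^'n \<Rightarrow> complex) \<Rightarrow> bool" where
  "k_harmonic Rp k p \<longleftrightarrow> (\<forall>x. (\<forall>\<alpha>\<in>Rp. \<alpha> \<bullet> x \<noteq> 0) \<longrightarrow> dunkl_laplacian Rp k p x = 0)"

section \<open>The \<open>(k,a)\<close>-generalized Fourier transform\<close>

definition laguerre :: "nat \<Rightarrow> real \<Rightarrow> real \<Rightarrow> real" where
  "laguerre l lam t =
     (\<Sum>j\<le>l. (- 1) ^ j * ((real l + lam) gchoose (l - j)) * t ^ j / fact j)"

definition lambda_ka :: "(real^'n) set \<Rightarrow> (real^'n \<Rightarrow> real) \<Rightarrow> real \<Rightarrow> nat \<Rightarrow> real" where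
  "lambda_ka Rp k a m = (2 * real m + 2 * k_index Rp k + real CARD('n) - 2) / a"

definition Phi_ka ::
    "(real^'n) set \<Rightarrow> (real^'n \<Rightarrow> real) \<Rightarrow> real \<Rightarrow> nat \<Rightarrow> nat \<Rightarrow> (real^'n \<Rightarrow> complex) \<Rightarrow>
     real^'n \<Rightarrow> complex" where
  "Phi_ka Rp k a l m p x =
     p x * complex_of_real (laguerre l (lambda_ka Rp k a m) (2 / a * norm x powr a)
                            * exp (- (norm x powr a) / a))"

text \<open>The values of \<open>F\<close> outside \<open>L\<^sup>2\<close> are irrelevant. Since the functions \<open>Phi_ka\<close>
  span a dense subspace of \<open>L\<^sup>2\<close>, the predicate determines \<open>F\<close> on \<open>L\<^sup>2\<close> up to null sets.\<close>

definition is_ka_fourier ::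
    "(real^'n) set \<Rightarrow> (real^'n \<Rightarrow> real) \<Rightarrow> real \<Rightarrow>
     ((real^'n \<Rightarrow> complex) \<Rightarrow> (real^'n \<Rightarrow> complex)) \<Rightarrow> bool" where
  "is_ka_fourier Rp k a F \<longleftrightarrow>
     unitary_on_L2 (mu_ka Rp k a) F \<and>
     (\<forall>l m p. homogeneous_polynomial m p \<and> k_harmonic Rp k p \<longrightarrow>
        (AE x in mu_ka Rp k a.
           F (Phi_ka Rp k a l m p) x =
             exp (- \<i> * complex_of_real (pi * (real l + real m / a))) * Phi_ka Rp k a l m p x))"

text \<open>Extension by continuity from \<open>L\<^sup>1 \<inter> L\<^sup>2\<close> to \<open>L\<^sup>1\<close> (with limits in \<open>L\<^sup>\<infinity>\<close>),
  and from there additively to \<open>L\<^sup>1 + L\<^sup>2\<close>. When \<open>F\<close> is unitary on \<open>L\<^sup>2\<close> and bounded from \<open>L\<^sup>1\<close>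
  to \<open>L\<^sup>\<infinity>\<close>, the chosen functions exist and are unique up to null sets.\<close>

definition extend_L1 ::
    "'a measure \<Rightarrow> (('a \<Rightarrow> complex) \<Rightarrow> ('a \<Rightarrow> complex)) \<Rightarrow> ('a \<Rightarrow> complex) \<Rightarrow> ('a \<Rightarrow> complex)"
where
  "extend_L1 M F f = (SOME g. g \<in> borel_measurable M \<and>
     (\<exists>s :: nat \<Rightarrow> 'a \<Rightarrow> complex.
        (\<forall>n. s n \<in> Lp_space M 1 \<inter> Lp_space M 2) \<and>
        (\<lambda>n. Lp_norm M 1 (\<lambda>x. s n x - f x)) \<longlonglongrightarrow> 0 \<and>
        (\<lambda>n. Linfty_norm M (\<lambda>x. F (s n) x - g x)) \<longlonglongrightarrow> 0))"

definition extend_L1_L2 ::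
    "'a measure \<Rightarrow> (('a \<Rightarrow> complex) \<Rightarrow> ('a \<Rightarrow> complex)) \<Rightarrow> ('a \<Rightarrow> complex) \<Rightarrow> ('a \<Rightarrow> complex)"
where
  "extend_L1_L2 M F f = (SOME g. \<exists>f1\<in>Lp_space M 1. \<exists>f2\<in>Lp_space M 2.
     (\<forall>x. f x = f1 x + f2 x) \<and> g = (\<lambda>x. extend_L1 M F f1 x + F f2 x))"

section \<open>Young functions and the spaces \<open>L\<^sup>(\<^sup>q\<^sup>)\<close>\<close>

definition young_function :: "'a measure \<Rightarrow> ('a \<Rightarrow> real) \<Rightarrow> bool" where
  "young_function M \<psi> \<longleftrightarrow> \<psi> \<in> borel_measurable M \<and>
     (\<exists>c\<ge>0. \<forall>t>0. emeasure M {x \<in> space M. \<bar>\<psi> x\<bar> \<le> t} \<le> ennreal (c * t))"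

definition Lq_young_space :: "'a measure \<Rightarrow> real \<Rightarrow> ('a \<Rightarrow> real) \<Rightarrow> ('a \<Rightarrow> complex) set" where
  "Lq_young_space M q \<psi> = {f \<in> borel_measurable M.
     integrable M (\<lambda>x. norm (f x) powr q * \<bar>\<psi> x\<bar> powr (q - 2))}"

definition Lq_young_norm :: "'a measure \<Rightarrow> real \<Rightarrow> ('a \<Rightarrow> real) \<Rightarrow> ('a \<Rightarrow> complex) \<Rightarrow> real" where
  "Lq_young_norm M q \<psi> f =
     (\<integral>x. norm (f x) powr q * \<bar>\<psi> x\<bar> powr (q - 2) \<partial>M) powr (1 / q)"

end

theory Submission
  imports Defs
begin

text \<open>
  Write \<open>\<phi> = \<bar>\<psi>\<bar>\<close> and \<open>\<mu>\<close> for the measure. Split \<open>f = u + v\<close> at a height \<open>s\<close>, with \<open>u\<close> supported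
  where a suitable function \<open>cut\<close> is below \<open>s\<close>. If \<open>cut\<close> dominates
  \<open>H(x) = \<integral>\<^bsub>\<phi> \<le> \<phi>(x)\<^esub> \<bar>f\<bar> d\<mu>\<close>, then \<open>u\<close> has \<open>L\<^sup>1\<close>-norm at most \<open>s\<close>, so its transform is bounded by \<open>C s\<close>,
  and Chebyshev's inequality together with the isometry on \<open>L\<^sup>2\<close> controls the transform of \<open>v\<close>.
  Integrating over \<open>s\<close> bounds the left-hand side by \<open>\<integral> \<bar>f\<bar>\<^sup>2 cut\<^sup>q\<^sup>-\<^sup>2 d\<mu>\<close>, hence by
  \<open>\<integral> \<bar>f\<bar>\<^sup>q \<phi>\<^sup>q\<^sup>-\<^sup>2 d\<mu> + \<integral> cut\<^sup>q \<phi>\<^sup>-\<^sup>2 d\<mu>\<close>; the last term is handled by a Hardy inequality, which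
  only uses that \<open>\<mu>(\<phi> \<le> t) \<le> c t\<close>.
\<close>

section \<open>Negative powers of a function with linearly bounded sublevel sets\<close>

lemma nn_integral_exp_atLeast:
  fixes r a :: real
  assumes "r > 0"
  shows "(\<integral>\<^sup>+t. ennreal (exp (- r * t)) * indicator {a..} t \<partial>lborel) = ennreal (exp (- r * a) / r)"
proof -
  have "((\<lambda>t. - (exp (- r * t) / r)) \<longlongrightarrow> 0) at_top"
    using assms by real_asymp
  then have "(\<integral>\<^sup>+t. ennreal (exp (- r * t)) * indicator {a..} t \<partial>lborel) = 0 - (- (exp (- r * a) / r))"
    using assms by (intro nn_integral_FTC_atLeast) (auto intro!: derivative_eq_intros)
  then show ?thesis by simp
qed

lemma nn_integral_exp_atMost:
  fixes r a :: real
  assumes "r > 0"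
  shows "(\<integral>\<^sup>+t. ennreal (exp (r * t)) * indicator {..a} t \<partial>lborel) = ennreal (exp (r * a) / r)"
proof -
  have "(\<integral>\<^sup>+t. ennreal (exp (r * t)) * indicator {..a} t \<partial>lborel)
      = (\<integral>\<^sup>+t. ennreal (exp (- r * t)) * indicator {-a..} t \<partial>lborel)"
    by (subst nn_integral_real_affine[where c = "-1" and t = 0])
      (auto intro!: nn_integral_cong simp: indicator_def)
  then show ?thesis
    using nn_integral_exp_atLeast[OF assms, of "-a"] by simp
qed

text \<open>This is the layer cake formula, \<open>y^r\<close> being \<open>r\<close> times the
  integral of \<open>s^(r-1)\<close> over \<open>0 < s <= y\<close>, after the substitution
  \<open>s = exp (- t)\<close>. Height integrals thereby run over the whole line with an exponential
  density.\<close>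

lemma powr_eq_nn_integral_exp:
  fixes r y :: real
  assumes "r > 0" "y \<ge> 0"
  shows "ennreal (y powr r) = ennreal r * (\<integral>\<^sup>+t. ennreal (exp (- r * t)) * indicator {t. exp (- t) \<le> y} t \<partial>lborel)"
proof (cases "y = 0")
  case True
  then show ?thesis by (simp add: not_le)
next
  case False
  with assms have y: "y > 0" by simp
  have "exp (- t) \<le> y \<longleftrightarrow> - ln y \<le> t" for t
    using ln_ge_iff[OF y, of "- t"] by linarith
  then have "{t. exp (- t) \<le> y} = {- ln y..}" by auto
  then show ?thesis
    using y assms nn_integral_exp_atLeast[OF \<open>r > 0\<close>, of "- ln y"]
    by (simp add: ennreal_mult'[symmetric] powr_def mult_ac)
qed

section \<open>Functions whose sublevel sets have linearly bounded measure\<close>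

locale linear_sublevel =
  fixes M :: "'a measure" and \<phi> :: "'a \<Rightarrow> real" and c :: real
  assumes measurable_phi[measurable]: "\<phi> \<in> borel_measurable M"
    and phi_nonneg: "\<phi> x \<ge> 0"
    and c_nonneg: "c \<ge> 0"
    and sublevel: "t > 0 \<Longrightarrow> emeasure M {x \<in> space M. \<phi> x \<le> t} \<le> ennreal (c * t)"
begin

text \<open>The sublevel sets of \<phi> at positive integers exhaust the space and have finite
  measure. The Fubini interchanges below rest on this.\<close>

sublocale sigma_finite_measure M
proof
  let ?A = "\<lambda>n::nat. {x \<in> space M. \<phi> x \<le> real (Suc n)}"
  have "\<exists>n. \<phi> x \<le> real (Suc n)" for x
    using real_arch_simple[of "\<phi> x"] by (metis of_nat_Suc add.commute add_increasing2 zero_le_one)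
  then have "\<Union> (range ?A) = space M" by auto
  moreover have "emeasure M (?A n) \<noteq> \<infinity>" for n
  proof -
    have "emeasure M (?A n) \<le> ennreal (c * Suc n)" by (intro sublevel) simp
    then show ?thesis by (auto simp: top_unique)
  qed
  ultimately show "\<exists>A. countable A \<and> A \<subseteq> sets M \<and> \<Union> A = space M \<and> (\<forall>a\<in>A. emeasure M a \<noteq> \<infinity>)"
    by (intro exI[of _ "range ?A"]) auto
qed

lemma AE_phi_pos: "AE x in M. \<phi> x > 0"
proof -
  let ?Z = "{x \<in> space M. \<not> \<phi> x > 0}"
  have "emeasure M ?Z \<le> 0 + ennreal e" if "e > 0" for e
  proof -
    \<comment> \<open>Dividing by \<open>c + 1\<close> rather than \<open>c\<close> covers
      \<open>c = 0\<close> as well.\<close>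
    have "emeasure M ?Z \<le> emeasure M {x \<in> space M. \<phi> x \<le> e / (c + 1)}"
      using that c_nonneg by (intro emeasure_mono) (auto intro: order.trans[of _ 0])
    also have "\<dots> \<le> ennreal (c * (e / (c + 1)))"
      using that c_nonneg by (intro sublevel) auto
    also have "\<dots> \<le> 0 + ennreal e"
      using that c_nonneg by (auto intro!: ennreal_leI simp: field_simps)
    finally show ?thesis .
  qed
  then have "emeasure M ?Z \<le> 0" by (rule ennreal_le_epsilon)
  then show ?thesis by (subst AE_iff_measurable[OF _ refl]) auto
qed

text \<open>The layer cake formula is applied to the inverse of \<phi>, where
  \<open>exp (- t) \<le> inverse (\<phi> x)\<close> forces \<open>\<phi> x \<le> exp t\<close>, and
  the integrals are exchanged. Only an inequality results: at a zero of \<phi> the power is 0 by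
  convention, although all sublevel conditions hold there.\<close>

lemma nn_integral_phi_powr_neg_le:
  assumes [measurable]: "A \<in> sets M" and "r > 0"
  shows "(\<integral>\<^sup>+x. ennreal (\<phi> x powr (- r)) * indicator A x \<partial>M)
    \<le> ennreal r * (\<integral>\<^sup>+t. ennreal (exp (- r * t)) *
        (\<integral>\<^sup>+x. indicator A x * indicator {x. \<phi> x \<le> exp t} x \<partial>M) \<partial>lborel)"
proof -
  interpret P: pair_sigma_finite lborel M ..
  let ?g = "\<lambda>t x. ennreal (exp (- r * t)) * (indicator A x * indicator {x. \<phi> x \<le> exp t} x)"
  have "(\<integral>\<^sup>+x. ennreal (\<phi> x powr (- r)) * indicator A x \<partial>M)
     \<le> (\<integral>\<^sup>+x. ennreal r * (\<integral>\<^sup>+t. ?g t x \<partial>lborel) \<partial>M)"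
  proof (intro nn_integral_mono)
    fix x
    have "\<phi> x \<le> exp t" if "exp (- t) \<le> inverse (\<phi> x)" for t
    proof (cases "\<phi> x > 0")
      case True
      then show ?thesis using that by (simp add: exp_minus)
    next
      case False
      then show ?thesis using phi_nonneg[of x] by (simp add: not_less order.trans[of _ 0])
    qed
    then have "(\<integral>\<^sup>+t. ennreal (exp (- r * t)) * indicator {t. exp (- t) \<le> inverse (\<phi> x)} t \<partial>lborel)
       \<le> (\<integral>\<^sup>+t. ennreal (exp (- r * t)) * indicator {x. \<phi> x \<le> exp t} x \<partial>lborel)"
      by (intro nn_integral_mono) (auto simp: indicator_def)
    moreover have "ennreal (\<phi> x powr (- r)) = ennreal r *
        (\<integral>\<^sup>+t. ennreal (exp (- r * t)) * indicator {t. exp (- t) \<le> inverse (\<phi> x)} t \<partial>lborel)"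
      using powr_eq_nn_integral_exp[OF \<open>r > 0\<close>, of "inverse (\<phi> x)"] phi_nonneg
      by (simp add: powr_minus inverse_powr)
    ultimately show "ennreal (\<phi> x powr (- r)) * indicator A x
        \<le> ennreal r * (\<integral>\<^sup>+t. ?g t x \<partial>lborel)"
      by (auto simp: indicator_def intro!: mult_left_mono)
  qed
  also have "\<dots> = ennreal r * (\<integral>\<^sup>+x. (\<integral>\<^sup>+t. ?g t x \<partial>lborel) \<partial>M)"
    by (intro nn_integral_cmult) measurable
  also have "(\<integral>\<^sup>+x. (\<integral>\<^sup>+t. ?g t x \<partial>lborel) \<partial>M) = (\<integral>\<^sup>+t. (\<integral>\<^sup>+x. ?g t x \<partial>M) \<partial>lborel)"
    by (intro P.Fubini') measurable
  also have "\<dots> = (\<integral>\<^sup>+t. ennreal (exp (- r * t)) *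
        (\<integral>\<^sup>+x. indicator A x * indicator {x. \<phi> x \<le> exp t} x \<partial>M) \<partial>lborel)"
    by (intro nn_integral_cong nn_integral_cmult) measurable
  finally show ?thesis .
qed

lemma nn_integral_sublevel_le:
  assumes "t > 0"
  shows "(\<integral>\<^sup>+x. indicator {x. \<phi> x \<le> t} x \<partial>M) \<le> ennreal (c * t)"
proof -
  have "(\<integral>\<^sup>+x. indicator {x. \<phi> x \<le> t} x \<partial>M) = (\<integral>\<^sup>+x. indicator {x \<in> space M. \<phi> x \<le> t} x \<partial>M)"
    by (intro nn_integral_cong) (auto simp: indicator_def)
  then show ?thesis using sublevel[OF assms] by simp
qed

text \<open>The part of the sublevel set where also \<open>\<phi> x \<le> exp t\<close> has measure
  at most \<open>c\<close> times the smaller of \<tau> and \<open>exp t\<close>. The two regimes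
  meet at \<open>t = ln \<tau>\<close>; \<open>\<gamma> < 1\<close> gives convergence as
  \<open>t\<close> tends to minus infinity, \<open>\<gamma> > 0\<close> as it tends to
  infinity.\<close>

lemma nn_integral_phi_powr_sublevel:
  assumes "0 < \<gamma>" "\<gamma> < 1" "\<tau> > 0"
  shows "(\<integral>\<^sup>+x. ennreal (\<phi> x powr (- \<gamma>)) * indicator {x. \<phi> x \<le> \<tau>} x \<partial>M)
    \<le> ennreal (c / (1 - \<gamma>) * \<tau> powr (1 - \<gamma>))"
proof -
  let ?A = "{x \<in> space M. \<phi> x \<le> \<tau>}"
  let ?L = "ln \<tau>"
  have "(\<integral>\<^sup>+x. ennreal (\<phi> x powr (- \<gamma>)) * indicator {x. \<phi> x \<le> \<tau>} x \<partial>M)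
     = (\<integral>\<^sup>+x. ennreal (\<phi> x powr (- \<gamma>)) * indicator ?A x \<partial>M)"
    by (intro nn_integral_cong) (auto simp: indicator_def)
  also have "\<dots> \<le> ennreal \<gamma> * (\<integral>\<^sup>+t. ennreal (exp (- \<gamma> * t)) *
        (\<integral>\<^sup>+x. indicator ?A x * indicator {x. \<phi> x \<le> exp t} x \<partial>M) \<partial>lborel)"
    using assms by (intro nn_integral_phi_powr_neg_le) auto
  also have "\<dots> \<le> ennreal \<gamma> * (\<integral>\<^sup>+t. ennreal (c * \<tau>) * (ennreal (exp (- \<gamma> * t)) * indicator {?L..} t)
      + ennreal c * (ennreal (exp ((1 - \<gamma>) * t)) * indicator {..?L} t) \<partial>lborel)"
  proof (intro mult_left_mono nn_integral_mono)
    fix t :: real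
    let ?I = "\<integral>\<^sup>+x. indicator ?A x * indicator {x. \<phi> x \<le> exp t} x \<partial>M"
    have "?I \<le> (\<integral>\<^sup>+x. indicator {x. \<phi> x \<le> \<tau>} x \<partial>M)"
      by (intro nn_integral_mono) (auto simp: indicator_def)
    also have "\<dots> \<le> ennreal (c * \<tau>)" by (intro nn_integral_sublevel_le assms)
    finally have 1: "?I \<le> ennreal (c * \<tau>)" .
    have "?I \<le> (\<integral>\<^sup>+x. indicator {x. \<phi> x \<le> exp t} x \<partial>M)"
      by (intro nn_integral_mono) (auto simp: indicator_def)
    also have "\<dots> \<le> ennreal (c * exp t)" by (intro nn_integral_sublevel_le) simp
    finally have "ennreal (exp (- \<gamma> * t)) * ?I \<le> ennreal (exp (- \<gamma> * t)) * ennreal (c * exp t)"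
      by (rule mult_left_mono) simp
    also have "\<dots> = ennreal c * ennreal (exp ((1 - \<gamma>) * t))"
      using c_nonneg by (simp add: ennreal_mult'[symmetric] algebra_simps flip: exp_add)
    finally have 2: "ennreal (exp (- \<gamma> * t)) * ?I \<le> ennreal c * ennreal (exp ((1 - \<gamma>) * t))" .
    show "ennreal (exp (- \<gamma> * t)) * ?I \<le> ennreal (c * \<tau>) * (ennreal (exp (- \<gamma> * t)) * indicator {?L..} t)
      + ennreal c * (ennreal (exp ((1 - \<gamma>) * t)) * indicator {..?L} t)"
    proof (cases "t \<ge> ?L")
      case True
      have "ennreal (exp (- \<gamma> * t)) * ?I \<le> ennreal (c * \<tau>) * ennreal (exp (- \<gamma> * t))"
        by (subst mult.commute[of "ennreal (c * \<tau>)"]) (rule mult_left_mono[OF 1], simp)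
      then show ?thesis using True by (simp add: add_increasing2)
    next
      case False
      then show ?thesis using 2 by simp
    qed
  qed simp
  also have "\<dots> = ennreal \<gamma> * (ennreal (c * \<tau>) * ennreal (exp (- \<gamma> * ?L) / \<gamma>)
      + ennreal c * ennreal (exp ((1 - \<gamma>) * ?L) / (1 - \<gamma>)))"
    using assms nn_integral_exp_atLeast[of \<gamma> ?L] nn_integral_exp_atMost[of "1 - \<gamma>" ?L]
    by (simp add: nn_integral_add nn_integral_cmult)
  also have "\<dots> = ennreal (\<gamma> * (c * \<tau> * (exp (- \<gamma> * ?L) / \<gamma>) + c * (exp ((1 - \<gamma>) * ?L) / (1 - \<gamma>))))"
    using assms c_nonneg by (simp add: ennreal_mult'[symmetric] ennreal_plus[symmetric] del: ennreal_plus)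
  also have "\<gamma> * (c * \<tau> * (exp (- \<gamma> * ?L) / \<gamma>) + c * (exp ((1 - \<gamma>) * ?L) / (1 - \<gamma>)))
      = c / (1 - \<gamma>) * \<tau> powr (1 - \<gamma>)"
  proof -
    have "exp (- \<gamma> * ?L) = \<tau> powr (1 - \<gamma>) / \<tau>" "exp ((1 - \<gamma>) * ?L) = \<tau> powr (1 - \<gamma>)"
      using assms by (auto simp: powr_def exp_diff left_diff_distrib exp_minus field_simps)
    moreover have "\<gamma> * (c * \<tau> * (P / \<tau> / \<gamma>) + c * (P / (1 - \<gamma>))) = c / (1 - \<gamma>) * P" for P
      using assms by (simp add: divide_simps) (simp add: algebra_simps)
    ultimately show ?thesis by metis
  qed
  finally show ?thesis .
qed

text \<open>Heights with \<open>exp t < \<tau>\<close> contribute nothing and the others at most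
  \<open>c * exp t\<close>. What remains has density \<open>exp (- (r - 1) * t)\<close>, integrable
  at infinity because \<open>r > 1\<close>.\<close>

lemma nn_integral_phi_powr_superlevel:
  assumes "\<tau> > 0" "r > 1"
  shows "(\<integral>\<^sup>+x. ennreal (\<phi> x powr (- r)) * indicator {x. \<tau> \<le> \<phi> x} x \<partial>M)
    \<le> ennreal (r / (r - 1) * c * \<tau> powr (1 - r))"
proof -
  let ?A = "{x \<in> space M. \<tau> \<le> \<phi> x}"
  let ?L = "ln \<tau>"
  have "(\<integral>\<^sup>+x. ennreal (\<phi> x powr (- r)) * indicator {x. \<tau> \<le> \<phi> x} x \<partial>M)
     = (\<integral>\<^sup>+x. ennreal (\<phi> x powr (- r)) * indicator ?A x \<partial>M)"
    by (intro nn_integral_cong) (auto simp: indicator_def)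
  also have "\<dots> \<le> ennreal r * (\<integral>\<^sup>+t. ennreal (exp (- r * t)) *
        (\<integral>\<^sup>+x. indicator ?A x * indicator {x. \<phi> x \<le> exp t} x \<partial>M) \<partial>lborel)"
    using assms by (intro nn_integral_phi_powr_neg_le) auto
  also have "\<dots> \<le> ennreal r * (\<integral>\<^sup>+t. ennreal c * (ennreal (exp (- (r - 1) * t)) * indicator {?L..} t) \<partial>lborel)"
  proof (intro mult_left_mono nn_integral_mono)
    fix t :: real
    let ?I = "\<integral>\<^sup>+x. indicator ?A x * indicator {x. \<phi> x \<le> exp t} x \<partial>M"
    show "ennreal (exp (- r * t)) * ?I \<le> ennreal c * (ennreal (exp (- (r - 1) * t)) * indicator {?L..} t)"
    proof (cases "t \<ge> ?L")
      case True
      have "?I \<le> (\<integral>\<^sup>+x. indicator {x. \<phi> x \<le> exp t} x \<partial>M)"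
        by (intro nn_integral_mono) (auto simp: indicator_def)
      also have "\<dots> \<le> ennreal (c * exp t)" by (intro nn_integral_sublevel_le) simp
      finally have "ennreal (exp (- r * t)) * ?I \<le> ennreal (exp (- r * t)) * ennreal (c * exp t)"
        by (rule mult_left_mono) simp
      also have "\<dots> = ennreal c * ennreal (exp (- (r - 1) * t))"
        using c_nonneg by (simp add: ennreal_mult'[symmetric] algebra_simps flip: exp_add)
      finally show ?thesis using True by simp
    next
      case False
      then have "exp t < \<tau>" using assms(1) by (metis exp_less_cancel_iff exp_ln not_le)
      then have "?I = (\<integral>\<^sup>+x. 0 \<partial>M)"
        by (intro nn_integral_cong) (auto simp: indicator_def)
      then show ?thesis by simp
    qed
  qed simp
  also have "\<dots> = ennreal r * (ennreal c * ennreal (exp (- (r - 1) * ?L) / (r - 1)))"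
    using assms nn_integral_exp_atLeast[of "r - 1" ?L] by (simp add: nn_integral_cmult)
  also have "\<dots> = ennreal (r * (c * (exp (- (r - 1) * ?L) / (r - 1))))"
    using assms c_nonneg by (simp add: ennreal_mult'[symmetric])
  also have "r * (c * (exp (- (r - 1) * ?L) / (r - 1))) = r / (r - 1) * c * \<tau> powr (1 - r)"
    using assms by (simp add: powr_def)
  finally show ?thesis .
qed

end

section \<open>A Hardy inequality\<close>

context linear_sublevel
begin

text \<open>If \<phi> attains a maximum on \<open>A\<close>, one sublevel set contains
  \<open>A\<close>. Otherwise an increasing sequence of sublevel sets at points of \<open>A\<close>
  covers \<open>A\<close>, and monotone convergence carries the bound over.\<close>

lemma nn_integral_le_of_sublevels:
  assumes [measurable]: "A \<in> sets M" "g \<in> borel_measurable M"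
    and le: "\<And>x. x \<in> A \<Longrightarrow> (\<integral>\<^sup>+y. g y * indicator {y. \<phi> y \<le> \<phi> x} y \<partial>M) \<le> S"
  shows "(\<integral>\<^sup>+y. g y * indicator A y \<partial>M) \<le> S"
proof (cases "\<exists>x\<in>A. \<forall>y\<in>A. \<phi> y \<le> \<phi> x")
  case True
  then obtain x where x: "x \<in> A" "\<And>y. y \<in> A \<Longrightarrow> \<phi> y \<le> \<phi> x" by auto
  have "(\<integral>\<^sup>+y. g y * indicator A y \<partial>M) \<le> (\<integral>\<^sup>+y. g y * indicator {y. \<phi> y \<le> \<phi> x} y \<partial>M)"
    using x by (intro nn_integral_mono) (auto simp: indicator_def)
  then show ?thesis using le[OF x(1)] by order
next
  case False
  show ?thesis
  proof (cases "A = {}")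
    case True
    then show ?thesis by simp
  next
    case False
    \<comment> \<open>The supremum is taken among extended values because \<phi> may be unbounded on
      \<open>A\<close>.\<close>
    let ?T = "(\<lambda>x. ennreal (\<phi> x)) ` A"
    obtain f :: "nat \<Rightarrow> ennreal" where f: "incseq f" "range f \<subseteq> ?T" "Sup ?T = (SUP i. f i)"
      using ennreal_Sup_countable_SUP[of ?T] False by auto
    have "\<forall>i. \<exists>x. x \<in> A \<and> f i = ennreal (\<phi> x)" using f(2) by auto
    then obtain y where y: "\<And>i. y i \<in> A" "\<And>i. f i = ennreal (\<phi> (y i))" by metis
    have inc: "incseq (\<lambda>i. \<phi> (y i))"
      using f(1) phi_nonneg by (simp add: incseq_def y(2))
    \<comment> \<open>As no maximum is attained, \<open>\<phi> x\<close> lies strictly below the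
      supremum, so some member of the sequence exceeds it.\<close>
    have ex: "\<exists>i. \<phi> x \<le> \<phi> (y i)" if x: "x \<in> A" for x
    proof -
      obtain x' where x': "x' \<in> A" "\<phi> x < \<phi> x'"
        using \<open>\<not> (\<exists>x\<in>A. \<forall>y\<in>A. \<phi> y \<le> \<phi> x)\<close> x by (meson not_le)
      have "ennreal (\<phi> x) < ennreal (\<phi> x')" using x' phi_nonneg by (simp add: ennreal_less_iff)
      also have "\<dots> \<le> (SUP i. f i)" using x' unfolding f(3)[symmetric] by (intro Sup_upper) auto
      finally obtain i where "ennreal (\<phi> x) < f i" by (auto simp: less_SUP_iff)
      then show ?thesis using phi_nonneg by (auto simp: y(2) ennreal_less_iff intro!: exI[of _ i])
    qed
    let ?g = "\<lambda>i z. g z * indicator {z. \<phi> z \<le> \<phi> (y i)} z"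
    have "(\<integral>\<^sup>+z. g z * indicator A z \<partial>M) \<le> (\<integral>\<^sup>+z. (SUP i. ?g i z) \<partial>M)"
    proof (intro nn_integral_mono)
      fix z
      show "g z * indicator A z \<le> (SUP i. ?g i z)"
      proof (cases "z \<in> A")
        case True
        then obtain i where "\<phi> z \<le> \<phi> (y i)" using ex by auto
        then show ?thesis using True by (intro SUP_upper2[of i]) auto
      qed simp
    qed
    also have "\<dots> = (SUP i. \<integral>\<^sup>+z. ?g i z \<partial>M)"
    proof (intro nn_integral_monotone_convergence_SUP)
      show "incseq ?g"
        using inc by (intro incseq_SucI le_funI)
          (auto simp: indicator_def dest: incseq_SucD intro: order.trans)
    qed measurable
    also have "\<dots> \<le> S" using le y(1) by (intro SUP_least) auto
    finally show ?thesis .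
  qed
qed

end

section \<open>Truncated integrals of a weighted function and their Hardy inequality\<close>

locale weighted_function = linear_sublevel M \<phi> c
  for M :: "'a measure" and \<phi> and c +
  fixes q :: real and h :: "'a \<Rightarrow> real"
  assumes q_gt_2: "q > 2"
    and measurable_h[measurable]: "h \<in> borel_measurable M"
    and h_nonneg: "h x \<ge> 0"
    and finite_weighted: "(\<integral>\<^sup>+x. ennreal (h x powr q * \<phi> x powr (q - 2)) \<partial>M) < \<infinity>"
begin

text \<open>Hoelder's inequality for \<open>h\<close> against the weight
  \<open>\<phi> powr (q - 3/2)\<close> leaves the dual factor
  \<open>\<phi> powr (- \<gamma>)\<close>. The exponent \<open>q - 3/2\<close> is the midpoint
  between \<open>q - 2\<close> and \<open>q - 1\<close>: lying below \<open>q - 1\<close> it gives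
  \<open>\<gamma> < 1\<close>, hence integrability over sublevel sets; lying above
  \<open>q - 2\<close> it makes the tail integral in the Hardy inequality converge.\<close>

definition \<gamma> :: real where "\<gamma> = (q - 3/2) / (q - 1)"

lemma gamma_bounds: "0 < \<gamma>" "\<gamma> < 1"
  using q_gt_2 by (auto simp: \<gamma>_def field_simps)

lemma gamma_eq: "\<gamma> * (q - 1) = q - 3/2" "(1 - \<gamma>) * (q - 1) = 1/2"
  using q_gt_2 by (auto simp: \<gamma>_def field_simps)

definition moment :: "real \<Rightarrow> real" where
  "moment \<tau> = enn2real (\<integral>\<^sup>+x. ennreal (h x powr q * \<phi> x powr (q - 3/2)) * indicator {x. \<phi> x \<le> \<tau>} x \<partial>M)"

text \<open>On the sublevel set the additional factor \<open>\<phi> x powr (1/2)\<close> is at most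
  \<open>\<tau> powr (1/2)\<close>, so \<open>finite_weighted\<close> makes the integral finite and
  \<open>enn2real\<close> in \<open>moment\<close> returns its true value.\<close>

lemma ennreal_moment:
  assumes "\<tau> \<ge> 0"
  shows "ennreal (moment \<tau>)
    = (\<integral>\<^sup>+x. ennreal (h x powr q * \<phi> x powr (q - 3/2)) * indicator {x. \<phi> x \<le> \<tau>} x \<partial>M)"
proof -
  have "(\<integral>\<^sup>+x. ennreal (h x powr q * \<phi> x powr (q - 3/2)) * indicator {x. \<phi> x \<le> \<tau>} x \<partial>M)
     \<le> (\<integral>\<^sup>+x. ennreal (\<tau> powr (1/2)) * ennreal (h x powr q * \<phi> x powr (q - 2)) \<partial>M)"
  proof (intro nn_integral_mono)
    fix x
    have eq: "\<phi> x powr (q - 3/2) = \<phi> x powr (1/2) * \<phi> x powr (q - 2)"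
      by (simp flip: powr_add)
    have "h x powr q * \<phi> x powr (q - 3/2) \<le> \<tau> powr (1/2) * (h x powr q * \<phi> x powr (q - 2))" if "\<phi> x \<le> \<tau>"
    proof -
      have "\<phi> x powr (1/2) * (h x powr q * \<phi> x powr (q - 2)) \<le> \<tau> powr (1/2) * (h x powr q * \<phi> x powr (q - 2))"
        using that phi_nonneg by (intro mult_right_mono powr_mono2) auto
      then show ?thesis unfolding eq by (simp add: mult_ac)
    qed
    then show "ennreal (h x powr q * \<phi> x powr (q - 3/2)) * indicator {x. \<phi> x \<le> \<tau>} x
        \<le> ennreal (\<tau> powr (1/2)) * ennreal (h x powr q * \<phi> x powr (q - 2))"
      by (auto simp: indicator_def ennreal_mult'[symmetric] intro!: ennreal_leI)
  qed
  also have "\<dots> = ennreal (\<tau> powr (1/2)) * (\<integral>\<^sup>+x. ennreal (h x powr q * \<phi> x powr (q - 2)) \<partial>M)"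
    by (rule nn_integral_cmult) measurable
  also have "\<dots> < \<infinity>" using finite_weighted by (simp add: ennreal_mult_less_top)
  finally show ?thesis unfolding moment_def by (simp add: less_top)
qed

lemma moment_nonneg: "moment \<tau> \<ge> 0"
  by (simp add: moment_def)

text \<open>The two summands come from the two pieces of the splitting below, which are in this
  proportion when the splitting parameter is optimal.\<close>

definition K :: real where "K = c / (1 - \<gamma>) + 1"

lemma K_pos: "K > 0"
  using gamma_bounds c_nonneg by (simp add: K_def add_nonneg_pos)

text \<open>Splitting according to whether \<open>h x\<close> exceeds \<open>l \<phi>(x)\<^sup>-\<^sup>\<gamma>\<close> and optimising over \<open>l\<close>
  replaces Hoelder's inequality.\<close>

lemma nn_integral_h_sublevel_le:
  assumes "\<tau> \<ge> 0"
  shows "(\<integral>\<^sup>+x. ennreal (h x) * indicator {x. \<phi> x \<le> \<tau>} x \<partial>M)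
    \<le> ennreal (K * (\<tau> powr (1/2) * moment \<tau>) powr (1/q))"
proof (cases "\<tau> = 0")
  case True
  have "(\<integral>\<^sup>+x. ennreal (h x) * indicator {x. \<phi> x \<le> \<tau>} x \<partial>M) = (\<integral>\<^sup>+x. 0 \<partial>M)"
    using AE_phi_pos by (intro nn_integral_cong_AE, eventually_elim) (auto simp: indicator_def True)
  then show ?thesis by simp
next
  case False
  with assms have \<tau>: "\<tau> > 0" by simp
  let ?H = "\<integral>\<^sup>+x. ennreal (h x) * indicator {x. \<phi> x \<le> \<tau>} x \<partial>M"
  let ?k = "c / (1 - \<gamma>) * \<tau> powr (1 - \<gamma>)"
  have split: "?H \<le> ennreal (l * ?k + l powr (1 - q) * moment \<tau>)" if l: "l > 0" for l
  proof -
    have "?H \<le> (\<integral>\<^sup>+x. ennreal l * (ennreal (\<phi> x powr (- \<gamma>)) * indicator {x. \<phi> x \<le> \<tau>} x)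
       + ennreal (l powr (1 - q)) * (ennreal (h x powr q * \<phi> x powr (q - 3/2)) * indicator {x. \<phi> x \<le> \<tau>} x) \<partial>M)"
    proof (intro nn_integral_mono_AE, use AE_phi_pos in eventually_elim)
      fix x assume x: "\<phi> x > 0"
      have "h x \<le> l * \<phi> x powr (- \<gamma>) + l powr (1 - q) * (h x powr q * \<phi> x powr (q - 3/2))"
      proof (cases "h x \<le> l * \<phi> x powr (- \<gamma>)")
        case True
        then show ?thesis by (simp add: add_increasing2)
      next
        case False
        then have gt: "l * \<phi> x powr (- \<gamma>) < h x" by simp
        have pos: "0 < l * \<phi> x powr (- \<gamma>)" using l x by simp
        then have hx: "h x > 0" using gt by linarith
        \<comment> \<open>The exponent \<open>1 - q\<close> is negative and reverses the lower bound
          on \<open>h x\<close>; then \<open>\<gamma> * (q - 1) = q - 3/2\<close> produces the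
          weight of \<open>moment\<close>.\<close>
        have "h x powr (1 - q) \<le> (l * \<phi> x powr (- \<gamma>)) powr (1 - q)"
          using gt pos q_gt_2 by (intro powr_mono2') auto
        also have "\<dots> = l powr (1 - q) * \<phi> x powr (\<gamma> * (q - 1))"
          using l x by (simp add: powr_mult powr_powr algebra_simps)
        finally have *: "h x powr (1 - q) \<le> l powr (1 - q) * \<phi> x powr (q - 3/2)"
          by (simp add: gamma_eq)
        have "h x = h x powr q * h x powr (1 - q)"
          using hx by (simp flip: powr_add)
        also have "\<dots> \<le> h x powr q * (l powr (1 - q) * \<phi> x powr (q - 3/2))"
          by (intro mult_left_mono *) simp
        finally show ?thesis using pos by (simp add: mult_ac)
      qed
      then show "ennreal (h x) * indicator {x. \<phi> x \<le> \<tau>} x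
        \<le> ennreal l * (ennreal (\<phi> x powr (- \<gamma>)) * indicator {x. \<phi> x \<le> \<tau>} x)
       + ennreal (l powr (1 - q)) * (ennreal (h x powr q * \<phi> x powr (q - 3/2)) * indicator {x. \<phi> x \<le> \<tau>} x)"
        using l by (auto simp: indicator_def ennreal_mult'[symmetric] ennreal_plus[symmetric] simp del: ennreal_plus
            intro!: ennreal_leI)
    qed
    also have "\<dots> = ennreal l * (\<integral>\<^sup>+x. ennreal (\<phi> x powr (- \<gamma>)) * indicator {x. \<phi> x \<le> \<tau>} x \<partial>M)
        + ennreal (l powr (1 - q)) * ennreal (moment \<tau>)"
      using \<tau> by (simp add: nn_integral_add nn_integral_cmult ennreal_moment)
    also have "\<dots> \<le> ennreal l * ennreal ?k + ennreal (l powr (1 - q)) * ennreal (moment \<tau>)"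
      by (intro add_right_mono mult_left_mono nn_integral_phi_powr_sublevel gamma_bounds \<tau>) simp
    also have "\<dots> = ennreal (l * ?k + l powr (1 - q) * moment \<tau>)"
      using l gamma_bounds c_nonneg moment_nonneg
      by (simp add: ennreal_mult'[symmetric] ennreal_plus[symmetric] del: ennreal_plus)
    finally show ?thesis .
  qed
  let ?e = "moment \<tau>"
  have k: "?k \<ge> 0" using gamma_bounds c_nonneg by simp
  show ?thesis
  proof (cases "?e = 0")
    case True
    \<comment> \<open>With vanishing moment the balancing parameter would be 0, so arbitrarily small
      positive \<open>l\<close> are used instead.\<close>
    have "?H \<le> 0 + ennreal d" if d: "d > 0" for d
    proof -
      have "?H \<le> ennreal (d / (?k + 1) * ?k)"
        using split[of "d / (?k + 1)"] d k True by simp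
      moreover have "d / (k' + 1) * k' \<le> d" if "k' \<ge> 0" for k' :: real
        using d that by (simp add: field_simps)
      from this[OF k] have "ennreal (d / (?k + 1) * ?k) \<le> ennreal d" by (rule ennreal_leI)
      ultimately show ?thesis by simp
    qed
    then have "?H \<le> 0" by (rule ennreal_le_epsilon)
    then show ?thesis by simp
  next
    case False
    then have e: "?e > 0" using moment_nonneg[of \<tau>] by simp
    \<comment> \<open>This \<open>l\<close> balances the two terms:
      \<open>l * \<tau> powr (1 - \<gamma>)\<close> and \<open>l powr (1 - q) * ?e\<close> both
      become \<open>P\<close>.\<close>
    define l where "l = (?e / \<tau> powr (1 - \<gamma>)) powr (1/q)"
    have l: "l > 0" using e \<tau> by (simp add: l_def)
    define P where "P = (\<tau> powr (1/2) * ?e) powr (1/q)"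
    have l_exp: "l = exp ((ln ?e - (1 - \<gamma>) * ln \<tau>) / q)"
      using e \<tau> by (simp add: l_def powr_def ln_div)
    have P_exp: "P = exp ((ln \<tau> / 2 + ln ?e) / q)"
      using e \<tau> by (simp add: P_def powr_def ln_mult)
    have g: "(1 - \<gamma>) * q = 1/2 + (1 - \<gamma>)" using gamma_eq(2) by (simp add: algebra_simps)
    have "l * \<tau> powr (1 - \<gamma>) = exp ((ln ?e - (1 - \<gamma>) * ln \<tau>) / q + (1 - \<gamma>) * ln \<tau>)"
      using \<tau> by (simp add: l_exp powr_def exp_add)
    also have "(ln ?e - (1 - \<gamma>) * ln \<tau>) / q + (1 - \<gamma>) * ln \<tau>
        = (ln ?e - (1 - \<gamma>) * ln \<tau> + ((1 - \<gamma>) * q) * ln \<tau>) / q"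
      using q_gt_2 by (simp add: field_simps)
    also have "\<dots> = (ln \<tau> / 2 + ln ?e) / q"
      unfolding g by (simp add: algebra_simps)
    finally have 1: "l * \<tau> powr (1 - \<gamma>) = P" by (simp add: P_exp)
    have "l powr (1 - q) * ?e = exp ((1 - q) * ((ln ?e - (1 - \<gamma>) * ln \<tau>) / q) + ln ?e)"
      using e l by (simp add: l_exp powr_def exp_add)
    also have "(1 - q) * ((ln ?e - (1 - \<gamma>) * ln \<tau>) / q) + ln ?e
       = (((1 - \<gamma>) * (q - 1)) * ln \<tau> + ln ?e) / q"
      using q_gt_2 by (simp add: field_simps)
    also have "\<dots> = (ln \<tau> / 2 + ln ?e) / q"
      unfolding gamma_eq by simp
    finally have 2: "l powr (1 - q) * ?e = P" by (simp add: P_exp)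
    have "l * ?k + l powr (1 - q) * ?e = c / (1 - \<gamma>) * (l * \<tau> powr (1 - \<gamma>)) + l powr (1 - q) * ?e"
      by simp
    also have "\<dots> = K * P" unfolding 1 2 by (simp add: K_def algebra_simps)
    finally show ?thesis using split[OF l] by (simp add: P_def)
  qed
qed

text \<open>This is the bound of \<open>nn_integral_h_sublevel_le\<close> at
  \<open>\<tau> = \<phi> x\<close>, so it dominates the integral of \<open>h\<close> over the
  sublevel set through \<open>x\<close>. Its \<open>q\<close>-th power is linear in
  \<open>moment\<close>, which reduces the Hardy inequality to an exchange of integrals.\<close>

definition cut :: "'a \<Rightarrow> real" where
  "cut x = K * (\<phi> x powr (1/2) * moment (\<phi> x)) powr (1/q)"

lemma cut_nonneg: "cut x \<ge> 0"
  using K_pos by (simp add: cut_def)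

lemma measurable_cut[measurable]: "cut \<in> borel_measurable M"
  unfolding cut_def moment_def by measurable

lemma nn_integral_h_cut_less:
  "(\<integral>\<^sup>+x. ennreal (h x) * indicator {x \<in> space M. cut x < s} x \<partial>M) \<le> ennreal s"
proof (rule nn_integral_le_of_sublevels)
  fix x assume "x \<in> {x \<in> space M. cut x < s}"
  then have "ennreal (cut x) \<le> ennreal s" by (auto intro: ennreal_leI)
  then show "(\<integral>\<^sup>+y. ennreal (h y) * indicator {y. \<phi> y \<le> \<phi> x} y \<partial>M) \<le> ennreal s"
    using nn_integral_h_sublevel_le[OF phi_nonneg[of x]] by (simp add: cut_def)
qed measurable

text \<open>The integrand is \<open>K powr q * moment (\<phi> x) * \<phi> x powr (- (3/2))\<close>.
  After exchanging the integrals, the inner one is that of \<open>\<phi> powr (- (3/2))\<close> over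
  a superlevel set, at most \<open>3 * c * \<phi> y powr (- (1/2))\<close>, which turns the weight
  exponent \<open>q - 3/2\<close> back into \<open>q - 2\<close>.\<close>

lemma nn_integral_cut_powr:
  "(\<integral>\<^sup>+x. ennreal (cut x powr q * \<phi> x powr (- 2)) \<partial>M)
    \<le> ennreal (3 * c * K powr q) * (\<integral>\<^sup>+x. ennreal (h x powr q * \<phi> x powr (q - 2)) \<partial>M)"
proof -
  interpret P: pair_sigma_finite M M ..
  let ?w = "\<lambda>y. ennreal (h y powr q * \<phi> y powr (q - 3/2))"
  let ?v = "\<lambda>x. ennreal (\<phi> x powr (- (3/2)))"
  have "(\<integral>\<^sup>+x. ennreal (cut x powr q * \<phi> x powr (- 2)) \<partial>M)
      = (\<integral>\<^sup>+x. ennreal (K powr q) * (\<integral>\<^sup>+y. ?w y * indicator {y. \<phi> y \<le> \<phi> x} y * ?v x \<partial>M) \<partial>M)"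
  proof (intro nn_integral_cong)
    fix x
    have "cut x powr q = K powr q * (\<phi> x powr (1/2) * moment (\<phi> x))"
      using K_pos moment_nonneg q_gt_2 by (simp add: cut_def powr_mult powr_powr)
    moreover have "\<phi> x powr (1/2) * \<phi> x powr (- 2) = \<phi> x powr (- (3/2))"
      by (simp flip: powr_add)
    ultimately have "cut x powr q * \<phi> x powr (- 2) = K powr q * (moment (\<phi> x) * \<phi> x powr (- (3/2)))"
      by simp
    then have "ennreal (cut x powr q * \<phi> x powr (- 2)) = ennreal (K powr q) * (ennreal (moment (\<phi> x)) * ?v x)"
      using moment_nonneg by (simp add: ennreal_mult'[symmetric])
    also have "ennreal (moment (\<phi> x)) * ?v x = (\<integral>\<^sup>+y. ?w y * indicator {y. \<phi> y \<le> \<phi> x} y * ?v x \<partial>M)"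
      unfolding ennreal_moment[OF phi_nonneg] by (rule nn_integral_multc[symmetric]) measurable
    finally show "ennreal (cut x powr q * \<phi> x powr (- 2))
        = ennreal (K powr q) * (\<integral>\<^sup>+y. ?w y * indicator {y. \<phi> y \<le> \<phi> x} y * ?v x \<partial>M)" .
  qed
  also have "\<dots> = ennreal (K powr q) * (\<integral>\<^sup>+x. (\<integral>\<^sup>+y. ?w y * indicator {y. \<phi> y \<le> \<phi> x} y * ?v x \<partial>M) \<partial>M)"
    by (rule nn_integral_cmult) measurable
  finally have outer: "(\<integral>\<^sup>+x. ennreal (cut x powr q * \<phi> x powr (- 2)) \<partial>M)
      = ennreal (K powr q) * (\<integral>\<^sup>+x. (\<integral>\<^sup>+y. ?w y * indicator {y. \<phi> y \<le> \<phi> x} y * ?v x \<partial>M) \<partial>M)" .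
  have "(\<integral>\<^sup>+x. (\<integral>\<^sup>+y. ?w y * indicator {y. \<phi> y \<le> \<phi> x} y * ?v x \<partial>M) \<partial>M)
     = (\<integral>\<^sup>+y. (\<integral>\<^sup>+x. ?w y * indicator {y. \<phi> y \<le> \<phi> x} y * ?v x \<partial>M) \<partial>M)"
    by (rule P.Fubini') measurable
  also have "\<dots> \<le> (\<integral>\<^sup>+y. ennreal (3 * c) * ennreal (h y powr q * \<phi> y powr (q - 2)) \<partial>M)"
  proof (intro nn_integral_mono_AE, use AE_phi_pos in eventually_elim)
    fix y assume y: "\<phi> y > 0"
    have "(\<integral>\<^sup>+x. ?w y * indicator {y. \<phi> y \<le> \<phi> x} y * ?v x \<partial>M)
        = (\<integral>\<^sup>+x. ?w y * (?v x * indicator {x. \<phi> y \<le> \<phi> x} x) \<partial>M)"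
      by (intro nn_integral_cong) (auto simp: indicator_def)
    also have "\<dots> = ?w y * (\<integral>\<^sup>+x. ?v x * indicator {x. \<phi> y \<le> \<phi> x} x \<partial>M)"
      by (rule nn_integral_cmult) measurable
    also have "\<dots> \<le> ?w y * ennreal (3/2 / (3/2 - 1) * c * \<phi> y powr (1 - 3/2))"
      by (intro mult_left_mono nn_integral_phi_powr_superlevel y) auto
    also have "\<dots> = ennreal (h y powr q * \<phi> y powr (q - 3/2) * (3 * c * \<phi> y powr (1 - 3/2)))"
      using c_nonneg by (simp add: ennreal_mult'[symmetric])
    also have "h y powr q * \<phi> y powr (q - 3/2) * (3 * c * \<phi> y powr (1 - 3/2))
       = 3 * c * (h y powr q * (\<phi> y powr (q - 3/2) * \<phi> y powr (1 - 3/2)))" by simp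
    also have "\<phi> y powr (q - 3/2) * \<phi> y powr (1 - 3/2) = \<phi> y powr (q - 2)"
      by (subst powr_add[symmetric]) (simp add: algebra_simps)
    also have "ennreal (3 * c * (h y powr q * \<phi> y powr (q - 2)))
       = ennreal (3 * c) * ennreal (h y powr q * \<phi> y powr (q - 2))"
      using c_nonneg by (intro ennreal_mult) auto
    finally show "(\<integral>\<^sup>+x. ?w y * indicator {y. \<phi> y \<le> \<phi> x} y * ?v x \<partial>M)
        \<le> ennreal (3 * c) * ennreal (h y powr q * \<phi> y powr (q - 2))" .
  qed
  also have "\<dots> = ennreal (3 * c) * (\<integral>\<^sup>+x. ennreal (h x powr q * \<phi> x powr (q - 2)) \<partial>M)"
    by (rule nn_integral_cmult) measurable
  finally have "(\<integral>\<^sup>+x. ennreal (cut x powr q * \<phi> x powr (- 2)) \<partial>M)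
     \<le> ennreal (K powr q) * (ennreal (3 * c) * (\<integral>\<^sup>+x. ennreal (h x powr q * \<phi> x powr (q - 2)) \<partial>M))"
    unfolding outer by (rule mult_left_mono) simp
  also have "\<dots> = ennreal (3 * c * K powr q) * (\<integral>\<^sup>+x. ennreal (h x powr q * \<phi> x powr (q - 2)) \<partial>M)"
    using c_nonneg by (simp add: ennreal_mult mult_ac)
  finally show ?thesis .
qed

text \<open>Pointwise dichotomy: if \<open>h x * \<phi> x \<le> cut x\<close>, replacing
  \<open>h x\<close> by \<open>cut x / \<phi> x\<close> gives the term with
  \<open>cut x powr q\<close>; otherwise replacing \<open>cut x\<close> by
  \<open>h x * \<phi> x\<close> gives the weighted term, as \<open>q > 2\<close>.\<close>

lemma nn_integral_h_cut:
  "(\<integral>\<^sup>+x. ennreal ((h x)\<^sup>2 * cut x powr (q - 2)) \<partial>M)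
    \<le> ennreal (1 + 3 * c * K powr q) * (\<integral>\<^sup>+x. ennreal (h x powr q * \<phi> x powr (q - 2)) \<partial>M)"
proof -
  let ?I = "\<integral>\<^sup>+x. ennreal (h x powr q * \<phi> x powr (q - 2)) \<partial>M"
  have "(\<integral>\<^sup>+x. ennreal ((h x)\<^sup>2 * cut x powr (q - 2)) \<partial>M)
    \<le> (\<integral>\<^sup>+x. ennreal (h x powr q * \<phi> x powr (q - 2)) + ennreal (cut x powr q * \<phi> x powr (- 2)) \<partial>M)"
  proof (intro nn_integral_mono_AE, use AE_phi_pos in eventually_elim)
    fix x assume x: "\<phi> x > 0"
    have "(h x)\<^sup>2 * cut x powr (q - 2) \<le> h x powr q * \<phi> x powr (q - 2) + cut x powr q * \<phi> x powr (- 2)"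
    proof (cases "h x * \<phi> x \<le> cut x")
      case True
      have "(h x * \<phi> x)\<^sup>2 * cut x powr (q - 2) \<le> (cut x)\<^sup>2 * cut x powr (q - 2)"
        using True h_nonneg x by (intro mult_right_mono power_mono) (auto simp: less_imp_le)
      also have "\<dots> = cut x powr q"
      proof (cases "cut x = 0")
        case False
        then have "cut x > 0" using cut_nonneg[of x] by simp
        then have "(cut x)\<^sup>2 = cut x powr 2" by (simp add: powr_numeral)
        then show ?thesis by (simp flip: powr_add)
      qed (use q_gt_2 in auto)
      finally have "(h x * \<phi> x)\<^sup>2 * cut x powr (q - 2) / (\<phi> x)\<^sup>2 \<le> cut x powr q / (\<phi> x)\<^sup>2"
        by (rule divide_right_mono) simp
      then have "(h x)\<^sup>2 * cut x powr (q - 2) \<le> cut x powr q * \<phi> x powr (- 2)"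
        using x by (simp add: power_mult_distrib powr_minus field_simps powr_numeral)
      then show ?thesis by (simp add: add_increasing)
    next
      case False
      then have lt: "cut x < h x * \<phi> x" by simp
      then have hx: "h x > 0" using cut_nonneg[of x] x by (metis le_less_trans zero_less_mult_pos2)
      have "(h x)\<^sup>2 * cut x powr (q - 2) \<le> (h x)\<^sup>2 * (h x * \<phi> x) powr (q - 2)"
        using lt cut_nonneg[of x] q_gt_2 by (intro mult_left_mono powr_mono2) auto
      also have "\<dots> = ((h x) powr 2 * h x powr (q - 2)) * \<phi> x powr (q - 2)"
        using hx x by (simp add: powr_mult powr_numeral)
      also have "h x powr 2 * h x powr (q - 2) = h x powr q"
        by (simp flip: powr_add)
      finally show ?thesis by (simp add: add_increasing2)
    qed
    then show "ennreal ((h x)\<^sup>2 * cut x powr (q - 2))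
      \<le> ennreal (h x powr q * \<phi> x powr (q - 2)) + ennreal (cut x powr q * \<phi> x powr (- 2))"
      by (simp add: ennreal_plus[symmetric] ennreal_leI del: ennreal_plus)
  qed
  also have "\<dots> = ?I + (\<integral>\<^sup>+x. ennreal (cut x powr q * \<phi> x powr (- 2)) \<partial>M)"
    by (rule nn_integral_add) measurable
  also have "\<dots> \<le> ?I + ennreal (3 * c * K powr q) * ?I"
    by (intro add_left_mono nn_integral_cut_powr)
  also have "\<dots> = ennreal (1 + 3 * c * K powr q) * ?I"
    using c_nonneg by (simp add: distrib_right)
  finally show ?thesis .
qed

text \<open>Passage from a weak to a strong estimate. The layer cake formula is used for
  \<open>G / 2\<close>, matching the level \<open>2 * s\<close> in \<open>weak\<close>; the
  Chebyshev factor \<open>s\<^sup>2\<close> lowers the exponent from \<open>q\<close> to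
  \<open>q - 2\<close>, and integrating over the heights again rebuilds
  \<open>cut x powr (q - 2)\<close>.\<close>

lemma nn_integral_powr_le:
  assumes [measurable]: "G \<in> borel_measurable M"
    and G_nonneg: "\<And>x. G x \<ge> 0"
    and weak: "\<And>s. s > 0 \<Longrightarrow> ennreal (s\<^sup>2) * emeasure M {x \<in> space M. 2 * s \<le> G x}
        \<le> (\<integral>\<^sup>+x. ennreal ((h x)\<^sup>2) * indicator {x. s \<le> cut x} x \<partial>M)"
  shows "(\<integral>\<^sup>+x. ennreal (G x powr q) \<partial>M)
    \<le> ennreal (2 powr q * q / (q - 2) * (1 + 3 * c * K powr q))
        * (\<integral>\<^sup>+x. ennreal (h x powr q * \<phi> x powr (q - 2)) \<partial>M)"
proof -
  interpret P: pair_sigma_finite lborel M ..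
  let ?C = "ennreal (2 powr q * q)"
  have "(\<integral>\<^sup>+x. ennreal (G x powr q) \<partial>M)
     = (\<integral>\<^sup>+x. ?C * (\<integral>\<^sup>+t. ennreal (exp (- q * t)) * indicator {t. exp (- t) \<le> G x / 2} t \<partial>lborel) \<partial>M)"
  proof (intro nn_integral_cong)
    fix x
    have "G x powr q = 2 powr q * (G x / 2) powr q"
      using G_nonneg[of x] by (simp add: powr_divide)
    then have "ennreal (G x powr q) = ennreal (2 powr q) * ennreal ((G x / 2) powr q)"
      by (simp add: ennreal_mult)
    also have "\<dots> = ?C * (\<integral>\<^sup>+t. ennreal (exp (- q * t)) * indicator {t. exp (- t) \<le> G x / 2} t \<partial>lborel)"
      using powr_eq_nn_integral_exp[of q "G x / 2"] q_gt_2 G_nonneg[of x]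
      by (simp add: ennreal_mult mult.assoc)
    finally show "ennreal (G x powr q)
      = ?C * (\<integral>\<^sup>+t. ennreal (exp (- q * t)) * indicator {t. exp (- t) \<le> G x / 2} t \<partial>lborel)" .
  qed
  also have "\<dots> = ?C * (\<integral>\<^sup>+x. (\<integral>\<^sup>+t. ennreal (exp (- q * t)) * indicator {t. exp (- t) \<le> G x / 2} t \<partial>lborel) \<partial>M)"
    by (rule nn_integral_cmult) measurable
  finally have outer: "(\<integral>\<^sup>+x. ennreal (G x powr q) \<partial>M) = ?C *
    (\<integral>\<^sup>+x. (\<integral>\<^sup>+t. ennreal (exp (- q * t)) * indicator {t. exp (- t) \<le> G x / 2} t \<partial>lborel) \<partial>M)" .
  have "(\<integral>\<^sup>+x. (\<integral>\<^sup>+t. ennreal (exp (- q * t)) * indicator {t. exp (- t) \<le> G x / 2} t \<partial>lborel) \<partial>M)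
     = (\<integral>\<^sup>+t. (\<integral>\<^sup>+x. ennreal (exp (- q * t)) * indicator {t. exp (- t) \<le> G x / 2} t \<partial>M) \<partial>lborel)"
    by (rule P.Fubini') measurable
  also have "\<dots> \<le> (\<integral>\<^sup>+t. (\<integral>\<^sup>+x. ennreal ((h x)\<^sup>2) * (ennreal (exp (- (q - 2) * t)) * indicator {t. exp (- t) \<le> cut x} t) \<partial>M) \<partial>lborel)"
  proof (rule nn_integral_mono)
    fix t :: real
    have "(\<integral>\<^sup>+x. ennreal (exp (- q * t)) * indicator {t. exp (- t) \<le> G x / 2} t \<partial>M)
        = (\<integral>\<^sup>+x. ennreal (exp (- q * t)) * indicator {x \<in> space M. 2 * exp (- t) \<le> G x} x \<partial>M)"
      by (intro nn_integral_cong) (auto simp: indicator_def)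
    also have "\<dots> = ennreal (exp (- q * t)) * emeasure M {x \<in> space M. 2 * exp (- t) \<le> G x}"
      by (simp add: nn_integral_cmult)
    \<comment> \<open>With \<open>s = exp (- t)\<close>, the factor \<open>s\<^sup>2\<close> is
      split off so that \<open>weak\<close> applies.\<close>
    also have "\<dots> = ennreal (exp (- (q - 2) * t)) * ennreal ((exp (- t))\<^sup>2)
        * emeasure M {x \<in> space M. 2 * exp (- t) \<le> G x}"
      by (subst ennreal_mult[symmetric])
        (auto simp: algebra_simps power2_eq_square simp flip: exp_add)
    also have "\<dots> \<le> ennreal (exp (- (q - 2) * t)) * (\<integral>\<^sup>+x. ennreal ((h x)\<^sup>2) * indicator {x. exp (- t) \<le> cut x} x \<partial>M)"
      unfolding mult.assoc by (intro mult_left_mono weak) auto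
    also have "\<dots> = (\<integral>\<^sup>+x. ennreal (exp (- (q - 2) * t)) * (ennreal ((h x)\<^sup>2) * indicator {x. exp (- t) \<le> cut x} x) \<partial>M)"
      by (rule nn_integral_cmult[symmetric]) measurable
    also have "\<dots> = (\<integral>\<^sup>+x. ennreal ((h x)\<^sup>2) * (ennreal (exp (- (q - 2) * t)) * indicator {t. exp (- t) \<le> cut x} t) \<partial>M)"
      by (intro nn_integral_cong) (auto simp: indicator_def mult.commute)
    finally show "(\<integral>\<^sup>+x. ennreal (exp (- q * t)) * indicator {t. exp (- t) \<le> G x / 2} t \<partial>M)
       \<le> (\<integral>\<^sup>+x. ennreal ((h x)\<^sup>2) * (ennreal (exp (- (q - 2) * t)) * indicator {t. exp (- t) \<le> cut x} t) \<partial>M)" .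
  qed
  also have "\<dots> = (\<integral>\<^sup>+x. (\<integral>\<^sup>+t. ennreal ((h x)\<^sup>2) * (ennreal (exp (- (q - 2) * t)) * indicator {t. exp (- t) \<le> cut x} t) \<partial>lborel) \<partial>M)"
    by (rule P.Fubini'[symmetric]) measurable
  also have "\<dots> = (\<integral>\<^sup>+x. ennreal (1 / (q - 2)) * ennreal ((h x)\<^sup>2 * cut x powr (q - 2)) \<partial>M)"
  proof (rule nn_integral_cong)
    fix x
    let ?J = "\<integral>\<^sup>+t. ennreal (exp (- (q - 2) * t)) * indicator {t. exp (- t) \<le> cut x} t \<partial>lborel"
    have P: "ennreal (cut x powr (q - 2)) = ennreal (q - 2) * ?J"
      using q_gt_2 cut_nonneg by (rule powr_eq_nn_integral_exp[OF diff_gt_0_iff_gt[THEN iffD2]])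
    \<comment> \<open>The layer cake formula with exponent \<open>q - 2\<close> is solved for
      \<open>?J\<close> by multiplying with the inverse constant.\<close>
    have one: "ennreal (1 / (q - 2)) * ennreal (q - 2) = 1"
      using q_gt_2 by (subst ennreal_mult[symmetric]) auto
    have J: "?J = ennreal (1 / (q - 2)) * ennreal (cut x powr (q - 2))"
      unfolding P mult.assoc[symmetric] one by simp
    have "(\<integral>\<^sup>+t. ennreal ((h x)\<^sup>2) * (ennreal (exp (- (q - 2) * t)) * indicator {t. exp (- t) \<le> cut x} t) \<partial>lborel)
       = ennreal ((h x)\<^sup>2) * ?J"
      by (rule nn_integral_cmult) measurable
    then show "(\<integral>\<^sup>+t. ennreal ((h x)\<^sup>2) * (ennreal (exp (- (q - 2) * t)) * indicator {t. exp (- t) \<le> cut x} t) \<partial>lborel)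
       = ennreal (1 / (q - 2)) * ennreal ((h x)\<^sup>2 * cut x powr (q - 2))"
      unfolding J by (simp only: ennreal_mult zero_le_power2 powr_ge_zero mult_ac)
  qed
  also have "\<dots> = ennreal (1 / (q - 2)) * (\<integral>\<^sup>+x. ennreal ((h x)\<^sup>2 * cut x powr (q - 2)) \<partial>M)"
    by (rule nn_integral_cmult) measurable
  also have "\<dots> \<le> ennreal (1 / (q - 2)) * (ennreal (1 + 3 * c * K powr q)
       * (\<integral>\<^sup>+x. ennreal (h x powr q * \<phi> x powr (q - 2)) \<partial>M))"
    by (intro mult_left_mono nn_integral_h_cut) simp
  finally have *: "(\<integral>\<^sup>+x. ennreal (G x powr q) \<partial>M) \<le> ?C * (ennreal (1 / (q - 2)) * (ennreal (1 + 3 * c * K powr q)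
       * (\<integral>\<^sup>+x. ennreal (h x powr q * \<phi> x powr (q - 2)) \<partial>M)))"
    unfolding outer by (rule mult_left_mono) simp
  have "0 \<le> 2 powr q * q" "0 \<le> 1 / (q - 2)" "0 \<le> 1 + 3 * c * K powr q"
    using q_gt_2 c_nonneg by auto
  then have C: "ennreal (2 powr q * q * (1 / (q - 2)) * (1 + 3 * c * K powr q))
      = ?C * ennreal (1 / (q - 2)) * ennreal (1 + 3 * c * K powr q)"
    by (metis ennreal_mult mult_nonneg_nonneg)
  show ?thesis using * C by (simp add: mult.assoc)
qed

end

section \<open>The extension of the transform\<close>

lemma Lp_space_1_iff:
  "f \<in> Lp_space M 1 \<longleftrightarrow> f \<in> borel_measurable M \<and> integrable M (\<lambda>x. norm (f x))"
  by (simp add: Lp_space_def)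

lemma Lp_space_2_iff:
  "f \<in> Lp_space M 2 \<longleftrightarrow> f \<in> borel_measurable M \<and> integrable M (\<lambda>x. (norm (f x))\<^sup>2)"
  by (simp add: Lp_space_def powr_numeral)

lemma Lp_norm_1: "Lp_norm M 1 f = (\<integral>x. norm (f x) \<partial>M)"
  by (simp add: Lp_norm_def)

lemma Lp_space_measurable: "f \<in> Lp_space M p \<Longrightarrow> f \<in> borel_measurable M"
  by (simp add: Lp_space_def)

lemma Lp_space_1_integrable: "f \<in> Lp_space M 1 \<Longrightarrow> integrable M f"
  using integrable_norm_cancel[of M f] by (simp add: Lp_space_1_iff)

lemma Lp_space_1_of_integrable: "integrable M f \<Longrightarrow> f \<in> Lp_space M 1"
  by (auto simp: Lp_space_1_iff)

lemma Lp_space_1_add: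
  "f \<in> Lp_space M 1 \<Longrightarrow> g \<in> Lp_space M 1 \<Longrightarrow> (\<lambda>x. f x + g x) \<in> Lp_space M 1"
  by (simp add: Lp_space_1_of_integrable Lp_space_1_integrable)

lemma Lp_space_1_diff:
  "f \<in> Lp_space M 1 \<Longrightarrow> g \<in> Lp_space M 1 \<Longrightarrow> (\<lambda>x. f x - g x) \<in> Lp_space M 1"
  by (simp add: Lp_space_1_of_integrable Lp_space_1_integrable)

lemma Lp_norm_1_add_le:
  assumes "f \<in> Lp_space M 1" "g \<in> Lp_space M 1"
  shows "Lp_norm M 1 (\<lambda>x. f x + g x) \<le> Lp_norm M 1 f + Lp_norm M 1 g"
proof -
  have "(\<integral>x. norm (f x + g x) \<partial>M) \<le> (\<integral>x. norm (f x) + norm (g x) \<partial>M)"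
    using assms Lp_space_1_add[OF assms]
    by (intro integral_mono) (auto simp: Lp_space_1_iff norm_triangle_ineq)
  also have "\<dots> = (\<integral>x. norm (f x) \<partial>M) + (\<integral>x. norm (g x) \<partial>M)"
    using assms by (intro Bochner_Integration.integral_add) (auto simp: Lp_space_1_iff)
  finally show ?thesis by (simp add: Lp_norm_1)
qed

lemma Lp_norm_minus_commute: "Lp_norm M p (\<lambda>x. f x - g x) = Lp_norm M p (\<lambda>x. g x - f x)"
  by (simp add: Lp_norm_def norm_minus_commute)

lemma Lp_space_2_lincomb:
  assumes "f \<in> Lp_space M 2" "g \<in> Lp_space M 2"
  shows "(\<lambda>x. a * f x + b * g x) \<in> Lp_space M 2"
proof -
  have [measurable]: "f \<in> borel_measurable M" "g \<in> borel_measurable M"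
    using assms by (auto dest: Lp_space_measurable)
  have "integrable M (\<lambda>x. 2 * (norm a)\<^sup>2 * (norm (f x))\<^sup>2 + 2 * (norm b)\<^sup>2 * (norm (g x))\<^sup>2)"
    using assms by (auto simp: Lp_space_2_iff)
  then have "integrable M (\<lambda>x. (norm (a * f x + b * g x))\<^sup>2)"
  proof (rule Bochner_Integration.integrable_bound)
    show "AE x in M. norm ((norm (a * f x + b * g x))\<^sup>2)
      \<le> norm (2 * (norm a)\<^sup>2 * (norm (f x))\<^sup>2 + 2 * (norm b)\<^sup>2 * (norm (g x))\<^sup>2)"
    proof (rule AE_I2)
      fix x
      have "(norm (a * f x + b * g x))\<^sup>2 \<le> (norm (a * f x) + norm (b * g x))\<^sup>2"
        by (intro power_mono norm_triangle_ineq) simp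
      also have "\<dots> \<le> 2 * (norm (a * f x))\<^sup>2 + 2 * (norm (b * g x))\<^sup>2"
        using sum_squares_bound[of "norm (a * f x)" "norm (b * g x)"] by (simp add: power2_sum)
      finally show "norm ((norm (a * f x + b * g x))\<^sup>2)
        \<le> norm (2 * (norm a)\<^sup>2 * (norm (f x))\<^sup>2 + 2 * (norm b)\<^sup>2 * (norm (g x))\<^sup>2)"
        by (simp add: norm_mult power_mult_distrib)
    qed
  qed measurable
  then show ?thesis by (simp add: Lp_space_2_iff)
qed

lemma Lp_space_2_add:
  "f \<in> Lp_space M 2 \<Longrightarrow> g \<in> Lp_space M 2 \<Longrightarrow> (\<lambda>x. f x + g x) \<in> Lp_space M 2"
  using Lp_space_2_lincomb[of f M g 1 1] by simp

lemma Lp_space_2_diff: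
  "f \<in> Lp_space M 2 \<Longrightarrow> g \<in> Lp_space M 2 \<Longrightarrow> (\<lambda>x. f x - g x) \<in> Lp_space M 2"
  using Lp_space_2_lincomb[of f M g 1 "-1"] by simp

lemma AE_Linfty_norm: "AE x in M. ennreal (norm (f x)) \<le> Linfty_norm M f"
  unfolding Linfty_norm_def by (rule esssup_AE)

section \<open>Extending an L2-unitary operator that is bounded from L1 to L-infinity\<close>

locale fourier_type =
  fixes M :: "'a measure" and F :: "('a \<Rightarrow> complex) \<Rightarrow> ('a \<Rightarrow> complex)" and C :: real
  assumes unitary: "unitary_on_L2 M F"
    and C_nonneg: "C \<ge> 0"
    and L1_Linfty: "f \<in> Lp_space M 1 \<Longrightarrow> f \<in> Lp_space M 2 \<Longrightarrow>
      Linfty_norm M (F f) \<le> ennreal (C * Lp_norm M 1 f)"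
begin

lemma F_L2: "f \<in> Lp_space M 2 \<Longrightarrow> F f \<in> Lp_space M 2"
  using unitary by (simp add: unitary_on_L2_def)

lemma F_lincomb:
  assumes "f \<in> Lp_space M 2" "g \<in> Lp_space M 2"
  shows "AE x in M. F (\<lambda>y. a * f y + b * g y) x = a * F f x + b * F g x"
  using unitary assms by (simp add: unitary_on_L2_def)

lemma F_add:
  assumes "f \<in> Lp_space M 2" "g \<in> Lp_space M 2"
  shows "AE x in M. F (\<lambda>y. f y + g y) x = F f x + F g x"
  using F_lincomb[OF assms, of 1 1] by simp

lemma F_diff:
  assumes "f \<in> Lp_space M 2" "g \<in> Lp_space M 2"
  shows "AE x in M. F (\<lambda>y. f y - g y) x = F f x - F g x"
  using F_lincomb[OF assms, of 1 "-1"] by simp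

lemma F_isometry:
  assumes "f \<in> Lp_space M 2"
  shows "(\<integral>x. (norm (F f x))\<^sup>2 \<partial>M) = (\<integral>x. (norm (f x))\<^sup>2 \<partial>M)"
proof -
  have "L2_inner M g g = of_real (\<integral>x. (norm (g x))\<^sup>2 \<partial>M)" for g
    unfolding L2_inner_def complex_norm_square[symmetric] by (rule integral_complex_of_real)
  moreover have "L2_inner M (F f) (F f) = L2_inner M f f"
    using unitary assms by (simp add: unitary_on_L2_def)
  ultimately show ?thesis by simp
qed

lemma nn_integral_F_isometry:
  assumes "f \<in> Lp_space M 2"
  shows "(\<integral>\<^sup>+x. ennreal ((norm (F f x))\<^sup>2) \<partial>M) = (\<integral>\<^sup>+x. ennreal ((norm (f x))\<^sup>2) \<partial>M)"
  using F_isometry[OF assms] assms F_L2[OF assms]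
  by (simp add: Lp_space_2_iff nn_integral_eq_integral)

lemma F_AE_bound:
  assumes "f \<in> Lp_space M 1" "f \<in> Lp_space M 2"
  shows "AE x in M. norm (F f x) \<le> C * Lp_norm M 1 f"
  using AE_Linfty_norm[of "F f" M]
proof eventually_elim
  fix x assume "ennreal (norm (F f x)) \<le> Linfty_norm M (F f)"
  also have "\<dots> \<le> ennreal (C * Lp_norm M 1 f)" using assms by (rule L1_Linfty)
  finally show "norm (F f x) \<le> C * Lp_norm M 1 f"
    using C_nonneg by (subst (asm) ennreal_le_iff) (auto simp: Lp_norm_1 integral_nonneg_AE)
qed

text \<open>Together with measurability of \<open>g\<close>, this is the condition under the choice
  in \<open>extend_L1\<close>, with the approximating sequence made explicit.\<close>

definition L1_approx :: "('a \<Rightarrow> complex) \<Rightarrow> ('a \<Rightarrow> complex) \<Rightarrow> (nat \<Rightarrow> 'a \<Rightarrow> complex) \<Rightarrow> bool" where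
  "L1_approx f g s \<longleftrightarrow> (\<forall>n. s n \<in> Lp_space M 1 \<inter> Lp_space M 2) \<and>
     (\<lambda>n. Lp_norm M 1 (\<lambda>x. s n x - f x)) \<longlonglongrightarrow> 0 \<and>
     (\<lambda>n. Linfty_norm M (\<lambda>x. F (s n) x - g x)) \<longlonglongrightarrow> 0"

text \<open>Truncating \<open>f\<close> where its modulus exceeds \<open>n\<close> gives functions
  in both spaces that converge in L1 by dominated convergence. The bound from L1 to L-infinity makes
  their transforms uniformly Cauchy off a null set, and their limit is \<open>g\<close>.\<close>

lemma L1_approx_exists:
  assumes f: "f \<in> Lp_space M 1"
  shows "\<exists>g. g \<in> borel_measurable M \<and> (\<exists>s. L1_approx f g s)"
proof -
  have f_meas[measurable]: "f \<in> borel_measurable M" using f by (rule Lp_space_measurable)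
  have f_int: "integrable M (\<lambda>x. norm (f x))" using f by (simp add: Lp_space_1_iff)
  define s where "s n x = (if norm (f x) \<le> real n then f x else 0)" for n :: nat and x
  have s_meas[measurable]: "s n \<in> borel_measurable M" for n unfolding s_def by measurable
  have s1: "s n \<in> Lp_space M 1" for n
  proof -
    have "integrable M (s n)"
      by (rule Bochner_Integration.integrable_bound[OF f_int]) (auto simp: s_def)
    then show ?thesis by (rule Lp_space_1_of_integrable)
  qed
  have s2: "s n \<in> Lp_space M 2" for n
  proof -
    have "integrable M (\<lambda>x. real n * norm (f x))" using f_int by simp
    then have "integrable M (\<lambda>x. (norm (s n x))\<^sup>2)"
      by (rule Bochner_Integration.integrable_bound)
        (auto simp: s_def power2_eq_square intro!: mult_right_mono)
    then show ?thesis by (simp add: Lp_space_2_iff)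
  qed
  define e where "e n = Lp_norm M 1 (\<lambda>x. s n x - f x)" for n
  have e: "e \<longlonglongrightarrow> 0"
  proof -
    have "(\<lambda>n. \<integral>x. norm (s n x - f x) \<partial>M) \<longlonglongrightarrow> (\<integral>x. 0 \<partial>M)"
    proof (rule integral_dominated_convergence[OF _ _ f_int])
      show "AE x in M. (\<lambda>n. norm (s n x - f x)) \<longlonglongrightarrow> 0"
      proof (rule AE_I2)
        fix x
        obtain N :: nat where N: "norm (f x) \<le> N" using real_arch_simple by blast
        have "\<forall>\<^sub>F n in sequentially. norm (s n x - f x) = 0"
          using eventually_ge_at_top[of N]
          by eventually_elim (use N in \<open>auto simp: s_def\<close>)
        then show "(\<lambda>n. norm (s n x - f x)) \<longlonglongrightarrow> 0" by (rule tendsto_eventually)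
      qed
    qed (auto simp: s_def)
    then show ?thesis by (simp add: e_def[abs_def] Lp_norm_1)
  qed
  have dist_le: "Lp_norm M 1 (\<lambda>x. s n x - s m x) \<le> e n + e m" for n m
    using Lp_norm_1_add_le[OF Lp_space_1_diff[OF s1[of n] f] Lp_space_1_diff[OF f s1[of m]]]
    by (simp add: e_def Lp_norm_minus_commute[of M 1 f])
  have "AE x in M. norm (F (s n) x - F (s m) x) \<le> C * (e n + e m)" for n m
    using F_AE_bound[OF Lp_space_1_diff[OF s1[of n] s1[of m]] Lp_space_2_diff[OF s2[of n] s2[of m]]]
      F_diff[OF s2[of n] s2[of m]]
  proof eventually_elim
    case (elim x)
    then show ?case using mult_left_mono[OF dist_le[of n m] C_nonneg] by simp
  qed
  \<comment> \<open>The countably many exceptional sets are merged into one, so that pointwise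
    limits can be taken.\<close>
  then have "AE x in M. \<forall>n m. norm (F (s n) x - F (s m) x) \<le> C * (e n + e m)"
    by (simp add: AE_all_countable)
  then have conv: "AE x in M. \<forall>n. norm (F (s n) x - lim (\<lambda>m. F (s m) x)) \<le> C * e n"
  proof eventually_elim
    case (elim x)
    have "Cauchy (\<lambda>n. F (s n) x)"
    proof (rule CauchyI)
      fix d :: real assume d: "d > 0"
      have "(\<lambda>n. C * e n) \<longlonglongrightarrow> C * 0" by (intro tendsto_intros e)
      then have "\<forall>\<^sub>F n in sequentially. C * e n < d / 2" using d by (intro order_tendstoD(2)) auto
      then obtain N where N: "\<And>n. n \<ge> N \<Longrightarrow> C * e n < d / 2" by (auto simp: eventually_sequentially)
      have "norm (F (s m) x - F (s n) x) < d" if "m \<ge> N" "n \<ge> N" for m n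
        using elim[rule_format, of m n] N[OF that(1)] N[OF that(2)] by (simp add: distrib_left)
      then show "\<exists>N. \<forall>m\<ge>N. \<forall>n\<ge>N. norm (F (s m) x - F (s n) x) < d" by blast
    qed
    then have L: "(\<lambda>m. F (s m) x) \<longlonglongrightarrow> lim (\<lambda>m. F (s m) x)"
      by (simp add: Cauchy_convergent convergent_LIMSEQ_iff[symmetric])
    show ?case
    proof
      fix n
      have "(\<lambda>m. norm (F (s n) x - F (s m) x)) \<longlonglongrightarrow> norm (F (s n) x - lim (\<lambda>m. F (s m) x))"
        by (intro tendsto_intros L)
      moreover have "(\<lambda>m. C * (e n + e m)) \<longlonglongrightarrow> C * (e n + 0)" by (intro tendsto_intros e)
      ultimately show "norm (F (s n) x - lim (\<lambda>m. F (s m) x)) \<le> C * e n"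
        using elim by (intro LIMSEQ_le[where Y = "\<lambda>m. C * (e n + e m)"]) auto
    qed
  qed
  \<comment> \<open>\<open>lim\<close> also has a value on the exceptional null set, so
    \<open>g\<close> is total, and it is measurable.\<close>
  define g where "g x = lim (\<lambda>m. F (s m) x)" for x
  have Fs_meas[measurable]: "F (s n) \<in> borel_measurable M" for n
    by (rule Lp_space_measurable[OF F_L2[OF s2]])
  have g_meas[measurable]: "g \<in> borel_measurable M" unfolding g_def by measurable
  have "Linfty_norm M (\<lambda>x. F (s n) x - g x) \<le> ennreal (C * e n)" for n
    unfolding Linfty_norm_def
  proof (rule esssup_I)
    show "AE x in M. ennreal (norm (F (s n) x - g x)) \<le> ennreal (C * e n)"
      using conv by eventually_elim (simp only: g_def ennreal_leI)
  qed measurable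
  moreover have "(\<lambda>n. ennreal (C * e n)) \<longlonglongrightarrow> ennreal (C * 0)"
    by (intro tendsto_ennrealI tendsto_mult tendsto_const e)
  ultimately have "(\<lambda>n. Linfty_norm M (\<lambda>x. F (s n) x - g x)) \<longlonglongrightarrow> 0"
    using tendsto_sandwich[OF _ _ tendsto_const, of 0 "\<lambda>n. Linfty_norm M (\<lambda>x. F (s n) x - g x)"
        sequentially "\<lambda>n. ennreal (C * e n)"] by simp
  then have "L1_approx f g s"
    using s1 s2 e by (simp add: L1_approx_def e_def[abs_def])
  then show ?thesis using g_meas by blast
qed

lemma extend_L1_approx:
  assumes "f \<in> Lp_space M 1"
  shows "extend_L1 M F f \<in> borel_measurable M" "\<exists>s. L1_approx f (extend_L1 M F f) s"
  using someI_ex[OF L1_approx_exists[OF assms]]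
  unfolding extend_L1_def L1_approx_def by auto

text \<open>Only an approximation of \<open>f1\<close> is used, so that no consistency of the extension
  with \<open>F\<close> on \<open>L\<^sup>1 \<inter> L\<^sup>2\<close> has to be established.\<close>

lemma extend_L1_diff_bound:
  assumes f1: "f1 \<in> Lp_space M 1" and f2: "f2 \<in> Lp_space M 2"
    and u: "u \<in> Lp_space M 1" and v: "v \<in> Lp_space M 2"
    and eq: "\<And>x. f1 x + f2 x = u x + v x"
  shows "AE x in M. norm (extend_L1 M F f1 x + F f2 x - F v x) \<le> C * Lp_norm M 1 u"
proof -
  let ?g = "extend_L1 M F f1"
  obtain s where "L1_approx f1 ?g s" using extend_L1_approx(2)[OF f1] by auto
  then have s1: "\<And>n. s n \<in> Lp_space M 1" and s2: "\<And>n. s n \<in> Lp_space M 2"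
    and e: "(\<lambda>n. Lp_norm M 1 (\<lambda>x. s n x - f1 x)) \<longlonglongrightarrow> 0"
    and L: "(\<lambda>n. Linfty_norm M (\<lambda>x. F (s n) x - ?g x)) \<longlonglongrightarrow> 0"
    by (auto simp: L1_approx_def)
  let ?e = "\<lambda>n. Lp_norm M 1 (\<lambda>x. s n x - f1 x)"
  let ?L = "\<lambda>n. Linfty_norm M (\<lambda>x. F (s n) x - ?g x)"
  have C_norm: "0 \<le> C * Lp_norm M 1 w" for w
    using C_nonneg by (simp add: Lp_norm_1 integral_nonneg_AE)
  have bound: "AE x in M. norm (F (s n) x + F f2 x - F v x) \<le> C * (?e n + Lp_norm M 1 u)" for n
  proof -
    \<comment> \<open>This function is visibly in L2, and since \<open>f1 + f2 = u + v\<close> it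
      equals \<open>(s n - f1) + u\<close>, hence is in L1 too. The uniform bound therefore applies
      to its transform.\<close>
    let ?w = "\<lambda>x. s n x + (f2 x - v x)"
    have w: "?w = (\<lambda>x. (s n x - f1 x) + u x)"
    proof
      fix x show "?w x = (s n x - f1 x) + u x" using eq[of x] by (simp add: algebra_simps)
    qed
    have d1: "(\<lambda>x. s n x - f1 x) \<in> Lp_space M 1" by (intro Lp_space_1_diff s1 f1)
    have w1: "?w \<in> Lp_space M 1" unfolding w by (intro Lp_space_1_add d1 u)
    have d2: "(\<lambda>x. f2 x - v x) \<in> Lp_space M 2" by (intro Lp_space_2_diff f2 v)
    have w2: "?w \<in> Lp_space M 2" by (intro Lp_space_2_add s2 d2)
    have le: "C * Lp_norm M 1 ?w \<le> C * (?e n + Lp_norm M 1 u)"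
      unfolding w by (intro mult_left_mono Lp_norm_1_add_le d1 u C_nonneg)
    from F_AE_bound[OF w1 w2] F_add[OF s2[of n] d2] F_diff[OF f2 v]
    show ?thesis
    proof eventually_elim
      case (elim x)
      then have eq: "F (s n) x + F f2 x - F v x = F ?w x" by simp
      show ?case unfolding eq using elim(1) le by (rule order.trans)
    qed
  qed
  have "AE x in M. \<forall>n. ennreal (norm (F (s n) x - ?g x)) \<le> ?L n"
    unfolding AE_all_countable by (intro allI AE_Linfty_norm)
  moreover have "AE x in M. \<forall>n. norm (F (s n) x + F f2 x - F v x) \<le> C * (?e n + Lp_norm M 1 u)"
    unfolding AE_all_countable by (intro allI bound)
  ultimately show ?thesis
  proof eventually_elim
    case (elim x)
    \<comment> \<open>Both errors \<open>?L n\<close> and \<open>?e n\<close> vanish in the limit;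
      it is taken among extended values because \<open>?L n\<close> is one.\<close>
    have "ennreal (norm (?g x + F f2 x - F v x)) \<le> ?L n + ennreal (C * (?e n + Lp_norm M 1 u))" for n
    proof -
      have "norm (?g x + F f2 x - F v x) = norm ((F (s n) x + F f2 x - F v x) - (F (s n) x - ?g x))"
        by (simp add: algebra_simps)
      also have "\<dots> \<le> norm (F (s n) x - ?g x) + norm (F (s n) x + F f2 x - F v x)"
        using norm_triangle_ineq4[of "F (s n) x + F f2 x - F v x" "F (s n) x - ?g x"] by linarith
      finally have "ennreal (norm (?g x + F f2 x - F v x))
          \<le> ennreal (norm (F (s n) x - ?g x)) + ennreal (norm (F (s n) x + F f2 x - F v x))"
        by (simp add: ennreal_plus[symmetric] ennreal_leI del: ennreal_plus)
      also have "\<dots> \<le> ?L n + ennreal (C * (?e n + Lp_norm M 1 u))"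
        using elim by (intro add_mono ennreal_leI) auto
      finally show ?thesis .
    qed
    moreover have "(\<lambda>n. ?L n + ennreal (C * (?e n + Lp_norm M 1 u))) \<longlonglongrightarrow> 0 + ennreal (C * (0 + Lp_norm M 1 u))"
      by (intro tendsto_add L tendsto_ennrealI tendsto_mult tendsto_const e)
    ultimately have "ennreal (norm (?g x + F f2 x - F v x)) \<le> 0 + ennreal (C * (0 + Lp_norm M 1 u))"
      by (intro LIMSEQ_le_const) auto
    then show ?case using C_norm[of u] by (simp add: ennreal_le_iff)
  qed
qed

end

section \<open>The inequality for Young functions\<close>

text \<open>The normalisation \<open>C \<ge> 1\<close> permits division by \<open>C\<close> and
  yields \<open>s \<le> C * s\<close> in the weak estimate. Measurability of \<psi> is listed
  separately because the sublevel locale only speaks of its modulus.\<close>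

locale young_fourier = fourier_type M F C + linear_sublevel M "\<lambda>x. \<bar>\<psi> x\<bar>" c
  for M :: "'a measure" and F C and \<psi> :: "'a \<Rightarrow> real" and c +
  fixes q :: real
  assumes q_gt_2': "q > 2" and C_ge_1: "C \<ge> 1"
    and measurable_psi[measurable]: "\<psi> \<in> borel_measurable M"
begin

text \<open>The splitting is at modulus 1 of \<psi>. The inner part is integrable by
  \<open>nn_integral_h_sublevel_le\<close>. On the outer part \<open>(norm (f x))\<^sup>2\<close> is
  at most the weighted integrand plus \<open>\<bar>\<psi> x\<bar> powr (- 2)\<close>, according to
  whether \<open>norm (f x) * \<bar>\<psi> x\<bar>\<close> exceeds 1, and the latter power is
  integrable there.\<close>

lemma Lq_young_space_decomposition:
  assumes f: "f \<in> Lq_young_space M q \<psi>"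
  shows "\<exists>f1\<in>Lp_space M 1. \<exists>f2\<in>Lp_space M 2. \<forall>x. f x = f1 x + f2 x"
proof -
  have f_meas[measurable]: "f \<in> borel_measurable M"
    and f_int: "integrable M (\<lambda>x. norm (f x) powr q * \<bar>\<psi> x\<bar> powr (q - 2))"
    using f by (auto simp: Lq_young_space_def)
  interpret weighted_function M "\<lambda>x. \<bar>\<psi> x\<bar>" c q "\<lambda>x. norm (f x)"
    using q_gt_2' f_int by unfold_locales (auto simp: nn_integral_eq_integral)
  define f1 where "f1 x = (if \<bar>\<psi> x\<bar> \<le> 1 then f x else 0)" for x
  define f2 where "f2 x = (if \<bar>\<psi> x\<bar> \<le> 1 then 0 else f x)" for x
  have [measurable]: "f1 \<in> borel_measurable M" "f2 \<in> borel_measurable M"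
    unfolding f1_def f2_def by measurable
  have "f1 \<in> Lp_space M 1"
  proof -
    have "(\<integral>\<^sup>+x. ennreal (norm (f1 x)) \<partial>M)
        = (\<integral>\<^sup>+x. ennreal (norm (f x)) * indicator {x. \<bar>\<psi> x\<bar> \<le> 1} x \<partial>M)"
      by (intro nn_integral_cong) (auto simp: f1_def indicator_def)
    also have "\<dots> < \<infinity>"
      by (rule le_less_trans[OF nn_integral_h_sublevel_le]) simp_all
    finally have "integrable M f1" by (intro integrableI_bounded) auto
    then show ?thesis by (rule Lp_space_1_of_integrable)
  qed
  moreover have "f2 \<in> Lp_space M 2"
  proof -
    let ?w = "\<lambda>x. norm (f x) powr q * \<bar>\<psi> x\<bar> powr (q - 2)"
    have "(\<integral>\<^sup>+x. ennreal (norm ((norm (f2 x))\<^sup>2)) \<partial>M)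
        \<le> (\<integral>\<^sup>+x. ennreal (?w x) + ennreal (\<bar>\<psi> x\<bar> powr (- 2)) * indicator {x. 1 \<le> \<bar>\<psi> x\<bar>} x \<partial>M)"
    proof (rule nn_integral_mono)
      fix x
      have "(norm (f x))\<^sup>2 \<le> ?w x + \<bar>\<psi> x\<bar> powr (- 2)" if gt: "\<bar>\<psi> x\<bar> > 1"
      proof (cases "norm (f x) * \<bar>\<psi> x\<bar> \<le> 1")
        case True
        then have "(norm (f x) * \<bar>\<psi> x\<bar>)\<^sup>2 \<le> 1\<^sup>2" by (intro power_mono) auto
        then have "(norm (f x))\<^sup>2 \<le> \<bar>\<psi> x\<bar> powr (- 2)"
          using gt by (simp add: powr_minus powr_numeral power_mult_distrib field_simps)
        then show ?thesis by (simp add: add_increasing)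
      next
        case False
        then have ge: "1 \<le> norm (f x) * \<bar>\<psi> x\<bar>" and pos: "norm (f x) > 0" by (auto simp: not_le)
        have "(norm (f x))\<^sup>2 * 1 \<le> (norm (f x))\<^sup>2 * (norm (f x) * \<bar>\<psi> x\<bar>) powr (q - 2)"
          using ge q_gt_2 by (intro mult_left_mono ge_one_powr_ge_zero) auto
        also have "\<dots> = norm (f x) powr 2 * norm (f x) powr (q - 2) * \<bar>\<psi> x\<bar> powr (q - 2)"
          by (simp add: powr_mult powr_numeral)
        also have "norm (f x) powr 2 * norm (f x) powr (q - 2) = norm (f x) powr q"
          by (subst powr_add[symmetric]) simp
        finally show ?thesis by (simp add: add_increasing2)
      qed
      then show "ennreal (norm ((norm (f2 x))\<^sup>2))
         \<le> ennreal (?w x) + ennreal (\<bar>\<psi> x\<bar> powr (- 2)) * indicator {x. 1 \<le> \<bar>\<psi> x\<bar>} x"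
        by (auto simp: f2_def indicator_def ennreal_plus[symmetric] simp del: ennreal_plus intro!: ennreal_leI)
    qed
    also have "\<dots> = (\<integral>\<^sup>+x. ennreal (?w x) \<partial>M)
        + (\<integral>\<^sup>+x. ennreal (\<bar>\<psi> x\<bar> powr (- 2)) * indicator {x. 1 \<le> \<bar>\<psi> x\<bar>} x \<partial>M)"
      by (rule nn_integral_add) measurable
    also have "\<dots> < \<infinity>"
      using finite_weighted le_less_trans[OF nn_integral_phi_powr_superlevel[of 1 2] ennreal_less_top] by simp
    finally have "integrable M (\<lambda>x. (norm (f2 x))\<^sup>2)" by (intro integrableI_bounded) auto
    then show ?thesis by (simp add: Lp_space_2_iff)
  qed
  moreover have "\<forall>x. f x = f1 x + f2 x" by (simp add: f1_def f2_def)
  ultimately show ?thesis by blast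
qed

text \<open>The existence of a decomposition gives the choice in \<open>extend_L1_L2\<close> its
  meaning. Nothing is known about which decomposition is chosen, so the estimate
  \<open>extend_L1_diff_bound\<close> allows arbitrary \<open>f1\<close> and
  \<open>f2\<close>.\<close>

lemma extend_L1_L2_cases:
  assumes f: "f \<in> Lq_young_space M q \<psi>"
  obtains f1 f2 where "f1 \<in> Lp_space M 1" "f2 \<in> Lp_space M 2" "\<And>x. f x = f1 x + f2 x"
    "extend_L1_L2 M F f = (\<lambda>x. extend_L1 M F f1 x + F f2 x)"
proof -
  have "\<exists>g. \<exists>f1\<in>Lp_space M 1. \<exists>f2\<in>Lp_space M 2.
     (\<forall>x. f x = f1 x + f2 x) \<and> g = (\<lambda>x. extend_L1 M F f1 x + F f2 x)"
    using Lq_young_space_decomposition[OF f] by blast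
  from someI_ex[OF this] show ?thesis
    using that unfolding extend_L1_L2_def by blast
qed

text \<open>\<open>nn_integral_powr_le\<close> is applied to the modulus of the transform divided by
  \<open>C\<close>. The constant is written out in full, which shows that it does not depend on
  \<open>f\<close>.\<close>

lemma extend_L1_L2_bound:
  assumes f: "f \<in> Lq_young_space M q \<psi>"
  shows "(\<integral>\<^sup>+x. ennreal (norm (extend_L1_L2 M F f x) powr q) \<partial>M)
    \<le> ennreal (C powr q * (2 powr q * q / (q - 2)
        * (1 + 3 * c * (c / (1 - (q - 3/2) / (q - 1)) + 1) powr q))
        * Lq_young_norm M q \<psi> f powr q)"
proof -
  have f_meas[measurable]: "f \<in> borel_measurable M"
    and f_int: "integrable M (\<lambda>x. norm (f x) powr q * \<bar>\<psi> x\<bar> powr (q - 2))"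
    using f by (auto simp: Lq_young_space_def)
  interpret weighted_function M "\<lambda>x. \<bar>\<psi> x\<bar>" c q "\<lambda>x. norm (f x)"
    using q_gt_2' f_int by unfold_locales (auto simp: nn_integral_eq_integral)
  obtain f1 f2 where f1: "f1 \<in> Lp_space M 1" and f2: "f2 \<in> Lp_space M 2"
    and f_eq: "\<And>x. f x = f1 x + f2 x"
    and ext: "extend_L1_L2 M F f = (\<lambda>x. extend_L1 M F f1 x + F f2 x)"
    using extend_L1_L2_cases[OF f] by blast
  define g where "g = extend_L1_L2 M F f"
  have [measurable]: "extend_L1 M F f1 \<in> borel_measurable M" "F f2 \<in> borel_measurable M"
    using extend_L1_approx(1)[OF f1] Lp_space_measurable[OF F_L2[OF f2]] by auto
  have g_meas[measurable]: "g \<in> borel_measurable M" unfolding g_def ext by measurable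
  have weak: "ennreal (s\<^sup>2) * emeasure M {x \<in> space M. 2 * s \<le> norm (g x) / C}
      \<le> (\<integral>\<^sup>+x. ennreal ((norm (f x))\<^sup>2) * indicator {x. s \<le> cut x} x \<partial>M)" (is "_ \<le> ?J")
    if s: "s > 0" for s
  \<comment> \<open>An infinite right-hand side is trivial; a finite one is what places the high
    part \<open>v\<close> in L2.\<close>
  proof (cases "?J = \<infinity>")
    case False
    define u where "u x = (if s \<le> cut x then 0 else f x)" for x
    define v where "v x = (if s \<le> cut x then f x else 0)" for x
    have [measurable]: "u \<in> borel_measurable M" "v \<in> borel_measurable M"
      unfolding u_def v_def by measurable
    have u_le: "(\<integral>\<^sup>+x. ennreal (norm (u x)) \<partial>M) \<le> ennreal s"
    proof -
      have "(\<integral>\<^sup>+x. ennreal (norm (u x)) \<partial>M)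
         = (\<integral>\<^sup>+x. ennreal (norm (f x)) * indicator {x \<in> space M. cut x < s} x \<partial>M)"
        by (intro nn_integral_cong) (auto simp: u_def indicator_def)
      then show ?thesis using nn_integral_h_cut_less[of s] by simp
    qed
    have "integrable M u"
      using u_le by (intro integrableI_bounded) (auto simp: less_top[symmetric] top_unique)
    then have u: "u \<in> Lp_space M 1" by (rule Lp_space_1_of_integrable)
    have norm_u: "Lp_norm M 1 u \<le> s"
      using u u_le s by (simp add: Lp_norm_1 Lp_space_1_iff nn_integral_eq_integral)
    have J: "(\<integral>\<^sup>+x. ennreal ((norm (v x))\<^sup>2) \<partial>M) = ?J"
      by (intro nn_integral_cong) (auto simp: v_def indicator_def)
    have "integrable M (\<lambda>x. (norm (v x))\<^sup>2)"
      using J False by (intro integrableI_bounded) (auto simp: less_top[symmetric])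
    then have v: "v \<in> Lp_space M 2" by (simp add: Lp_space_2_iff)
    have eq: "f1 x + f2 x = u x + v x" for x
      by (simp add: f_eq[symmetric] u_def v_def)
    have "ennreal (s\<^sup>2) * emeasure M {x \<in> space M. 2 * s \<le> norm (g x) / C}
       = (\<integral>\<^sup>+x. ennreal (s\<^sup>2) * indicator {x \<in> space M. 2 * s \<le> norm (g x) / C} x \<partial>M)"
      by (rule nn_integral_cmult_indicator[symmetric]) measurable
    also have "\<dots> \<le> (\<integral>\<^sup>+x. ennreal ((norm (F v x))\<^sup>2) \<partial>M)"
      using extend_L1_diff_bound[OF f1 f2 u v eq]
    proof (intro nn_integral_mono_AE, eventually_elim)
      case (elim x)
      \<comment> \<open>Here \<open>norm (g x)\<close> is at least \<open>2 * C * s\<close>, while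
        \<open>g x\<close> differs from \<open>F v x\<close> by at most \<open>C * s\<close>; hence
        \<open>norm (F v x)\<close> is at least \<open>C * s\<close>, and so at least
        \<open>s\<close>.\<close>
      have "s\<^sup>2 \<le> (norm (F v x))\<^sup>2" if "2 * s \<le> norm (g x) / C"
      proof -
        have "C * Lp_norm M 1 u \<le> C * s" using norm_u C_nonneg by (rule mult_left_mono)
        moreover have "2 * (C * s) \<le> norm (g x)" using that C_ge_1 by (simp add: field_simps)
        moreover have "norm (g x) - norm (F v x) \<le> norm (g x - F v x)" by (rule norm_triangle_ineq2)
        ultimately have "C * s \<le> norm (F v x)" using elim by (simp add: g_def ext algebra_simps)
        moreover have "s \<le> C * s" using C_ge_1 s by simp
        ultimately have "s \<le> norm (F v x)" by linarith
        then show ?thesis using s by (intro power_mono) auto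
      qed
      then show ?case by (auto simp: indicator_def intro!: ennreal_leI)
    qed
    also have "\<dots> = ?J" using nn_integral_F_isometry[OF v] J by simp
    finally show ?thesis .
  qed simp
  define B where "B = 2 powr q * q / (q - 2) * (1 + 3 * c * K powr q)"
  let ?I = "\<integral>x. norm (f x) powr q * \<bar>\<psi> x\<bar> powr (q - 2) \<partial>M"
  have I: "?I \<ge> 0" by (intro integral_nonneg_AE) auto
  have nn_I: "(\<integral>\<^sup>+x. ennreal (norm (f x) powr q * \<bar>\<psi> x\<bar> powr (q - 2)) \<partial>M) = ennreal ?I"
    by (rule nn_integral_eq_integral[OF f_int]) simp
  have B: "B \<ge> 0" using q_gt_2 c_nonneg by (simp add: B_def)
  have "(\<integral>\<^sup>+x. ennreal (norm (g x) powr q) \<partial>M)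
      = (\<integral>\<^sup>+x. ennreal (C powr q) * ennreal ((norm (g x) / C) powr q) \<partial>M)"
    using C_ge_1 by (intro nn_integral_cong) (simp add: powr_divide ennreal_mult[symmetric])
  also have "\<dots> = ennreal (C powr q) * (\<integral>\<^sup>+x. ennreal ((norm (g x) / C) powr q) \<partial>M)"
    by (rule nn_integral_cmult) measurable
  also have "\<dots> \<le> ennreal (C powr q) * (ennreal B * (\<integral>\<^sup>+x. ennreal (norm (f x) powr q * \<bar>\<psi> x\<bar> powr (q - 2)) \<partial>M))"
    unfolding B_def using C_nonneg
    by (intro mult_left_mono nn_integral_powr_le weak) auto
  also have "\<dots> = ennreal (C powr q * B * ?I)"
    unfolding nn_I using I B by (simp add: ennreal_mult mult.assoc)
  also have "?I = Lq_young_norm M q \<psi> f powr q"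
    using I q_gt_2 by (simp add: Lq_young_norm_def powr_powr)
  finally show ?thesis by (simp add: g_def B_def K_def \<gamma>_def)
qed

end

section \<open>The inequality for the generalized Fourier transform\<close>

theorem theorem4p5:
  fixes R Rp :: "(real^'n) set"
    and k :: "real^'n \<Rightarrow> real"
    and a q :: real
    and F :: "(real^'n \<Rightarrow> complex) \<Rightarrow> (real^'n \<Rightarrow> complex)"
    and \<psi> :: "real^'n \<Rightarrow> real"
  assumes "reduced_root_system R"
    and "positive_subsystem R Rp"
    and "multiplicity_function R k"
    and "a > 0"
    and "a + 2 * k_index Rp k + real CARD('n) > 2"
    and "is_ka_fourier Rp k a F"
    and "\<exists>C0::real. \<forall>f \<in> Lp_space (mu_ka Rp k a) 1 \<inter> Lp_space (mu_ka Rp k a) 2.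
           Linfty_norm (mu_ka Rp k a) (F f) \<le> ennreal (C0 * Lp_norm (mu_ka Rp k a) 1 f)"
    and "q > 2"
    and "young_function (mu_ka Rp k a) \<psi>"
  shows "\<exists>D>0. \<forall>f \<in> Lq_young_space (mu_ka Rp k a) q \<psi>.
           (\<integral>\<^sup>+ \<xi>. ennreal (norm (extend_L1_L2 (mu_ka Rp k a) F f \<xi>) powr q) \<partial>mu_ka Rp k a)
             \<le> ennreal (D powr q * Lq_young_norm (mu_ka Rp k a) q \<psi> f powr q)"
proof -
  let ?M = "mu_ka Rp k a"
  obtain C0 :: real where C0: "\<And>f. f \<in> Lp_space ?M 1 \<Longrightarrow> f \<in> Lp_space ?M 2 \<Longrightarrow>
      Linfty_norm ?M (F f) \<le> ennreal (C0 * Lp_norm ?M 1 f)"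
    using assms(7) by blast
  obtain c where c: "c \<ge> 0" "\<And>t. t > 0 \<Longrightarrow> emeasure ?M {x \<in> space ?M. \<bar>\<psi> x\<bar> \<le> t} \<le> ennreal (c * t)"
    and \<psi>: "\<psi> \<in> borel_measurable ?M"
    using assms(9) by (auto simp: young_function_def)
  \<comment> \<open>The given constant may be small or negative; enlarging it preserves the bound
    because \<open>Lp_norm\<close> is nonnegative.\<close>
  define C where "C = max C0 1"
  interpret young_fourier ?M F C \<psi> c q
  proof
    show "unitary_on_L2 ?M F" using assms(6) by (simp add: is_ka_fourier_def)
    show "Linfty_norm ?M (F f) \<le> ennreal (C * Lp_norm ?M 1 f)"
      if "f \<in> Lp_space ?M 1" "f \<in> Lp_space ?M 2" for f
    proof -
      have "C0 * Lp_norm ?M 1 f \<le> C * Lp_norm ?M 1 f"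
        by (intro mult_right_mono) (auto simp: C_def Lp_norm_def)
      then show ?thesis using C0[OF that] by (meson ennreal_leI order.trans)
    qed
  qed (use c \<psi> assms(8) in \<open>auto simp: C_def\<close>)
  define B where "B = C powr q * (2 powr q * q / (q - 2)
        * (1 + 3 * c * (c / (1 - (q - 3/2) / (q - 1)) + 1) powr q))"
  have "B > 0"
    using assms(8) c(1) C_ge_1 unfolding B_def
    by (intro mult_pos_pos divide_pos_pos add_pos_nonneg mult_nonneg_nonneg) auto
  \<comment> \<open>The witness for \<open>D\<close> is the \<open>q\<close>-th root of
    \<open>B\<close>, which is independent of \<open>f\<close>.\<close>
  then have "(B powr (1 / q)) powr q = B" using assms(8) by (simp add: powr_powr)
  moreover have "B powr (1 / q) > 0" using \<open>B > 0\<close> by simp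
  ultimately show ?thesis
    using extend_L1_L2_bound unfolding B_def by metis
qed

end
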